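(* Let $\varphi_1$ and $\varphi_2$ be the nilpotent Jordan algebra laws on $\mathbb{C}^4$ with basis $\{e_1,e_2,e_3,e_4\}$ given by $$\varphi_1(e_1,e_1)=e_2,\quad \varphi_1(e_1,e_2)=e_3,\quad \varphi_1(e_1,e_3)=e_4,\quad \varphi_1(e_2,e_2)=e_4,$$ $$\varphi_2(e_1,e_1)=e_2,\quad \varphi_2(e_1,e_2)=e_3,\quad \varphi_2(e_4,e_4)=e_2.$$ Then the variety $\mathcal{J}^4$ of nilpotent complex Jordan algebra laws on $\mathbb{C}^4$ is the union of two irreducible components, namely $$\mathcal{J}^4=\overline{\mathcal{O}(\varphi_1)}^Z\cup\overline{\mathcal{O}(\varphi_2)}^Z,$$ where $\overline{\mathcal{O}(\varphi_1)}^Z$ and $\overline{\mathcal{O}(\varphi_2)}^Z$ are the two irreducible components.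
   Context: A complex Jordan algebra $J=(V,\varphi)$ is a complex vector space $V$ with a symmetric bilinear map $\varphi:V\times V\to V$ satisfying $\varphi(\varphi(x,x),\varphi(x,y))=\varphi(x,\varphi(\varphi(x,x),y))$ for all $x,y\in V$. Put $\mathcal{C}^1(J)=J$ and $\mathcal{C}^{m+1}(J)=\varphi(\mathcal{C}^m(J),J)$ (linear span of products); $J$ is nilpotent if $\mathcal{C}^k(J)=\{0\}$ for some $k$. In listing an algebra, all products of basis vectors not listed (and not obtained from listed ones by symmetry) are zero. Fixing a basis $\{e_1,\dots,e_n\}$ of $\mathbb{C}^n$, a law $\varphi$ is identified with its structure constants $(a_{ij}^k)\in\mathbb{C}^{n^3}$, $\varphi(e_i,e_j)=\sum_k a_{ij}^k e_k$. $\mathcal{J}^n\subset\mathbb{C}^{n^3}$ is the algebraic variety of all nilpotent Jordan algebra laws on $\mathbb{C}^n$ (including the Abelian law $\varphi\equiv 0$), with the Zariski topology. $\mathcal{O}(\varphi)$ is the orbit of $\varphi\in\mathcal{J}^n$ under the action of $GL(n,\mathbb{C})$, $(f\cdot\varphi)(x,y)=f^{-1}(\varphi(f(x),f(y)))$, and $\overline{\mathcal{O}(\varphi)}^Z$ is its Zariski closure. *)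

theory Defs
  imports "HOL-Analysis.Analysis"
begin

text \<open>Linearity is over the complex numbers: \<^term>\<open>(*s)\<close> is the scalar action of the base field on
  \<^typ>\<open>complex^'n\<close>, whereas the library's \<^const>\<open>bilinear\<close> is real bilinearity.\<close>

definition cbilinear :: "(complex^'n \<Rightarrow> complex^'n \<Rightarrow> complex^'n) \<Rightarrow> bool" where
  "cbilinear \<phi> \<longleftrightarrow>
     (\<forall>x. Vector_Spaces.linear (*s) (*s) (\<lambda>y. \<phi> x y)) \<and>
     (\<forall>y. Vector_Spaces.linear (*s) (*s) (\<lambda>x. \<phi> x y))"

definition jordan_law :: "(complex^'n \<Rightarrow> complex^'n \<Rightarrow> complex^'n) \<Rightarrow> bool" where
  "jordan_law \<phi> \<longleftrightarrow>
     cbilinear \<phi> \<and>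
     (\<forall>x y. \<phi> x y = \<phi> y x) \<and>
     (\<forall>x y. \<phi> (\<phi> x x) (\<phi> x y) = \<phi> x (\<phi> (\<phi> x x) y))"

text \<open>The index is shifted by one: \<open>central_series \<phi> m\<close> is $\mathcal{C}^{m+1}$.\<close>

primrec central_series :: "(complex^'n \<Rightarrow> complex^'n \<Rightarrow> complex^'n) \<Rightarrow> nat \<Rightarrow> (complex^'n) set" where
  "central_series \<phi> 0 = UNIV"
| "central_series \<phi> (Suc m) = vec.span {\<phi> x y | x y. x \<in> central_series \<phi> m}"

definition nilpotent_law :: "(complex^'n \<Rightarrow> complex^'n \<Rightarrow> complex^'n) \<Rightarrow> bool" where
  "nilpotent_law \<phi> \<longleftrightarrow> (\<exists>m. central_series \<phi> m = {0})"

text \<open>Affine space $\mathbb{C}^{n^3}$ is the type \<open>complex^('n \<times> 'n \<times> 'n)\<close>;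
  the coordinate \<open>(i, j, k)\<close> is $a_{ij}^k$.\<close>

definition structure_constants ::
    "(complex^'n \<Rightarrow> complex^'n \<Rightarrow> complex^'n) \<Rightarrow> complex^('n \<times> 'n \<times> 'n)" where
  "structure_constants \<phi> = vec_lambda (\<lambda>(i, j, k). \<phi> (axis i 1) (axis j 1) $ k)"

definition nilpotent_jordan_variety :: "(complex^('n::finite \<times> 'n \<times> 'n)) set" where
  "nilpotent_jordan_variety = {structure_constants \<phi> | \<phi> :: complex^'n \<Rightarrow> complex^'n \<Rightarrow> complex^'n.
     jordan_law \<phi> \<and> nilpotent_law \<phi>}"

definition transport_law ::
    "complex^'n^'n \<Rightarrow> (complex^'n \<Rightarrow> complex^'n \<Rightarrow> complex^'n) \<Rightarrow> (complex^'n \<Rightarrow> complex^'n \<Rightarrow> complex^'n)" where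
  "transport_law f \<phi> = (\<lambda>x y. matrix_inv f *v \<phi> (f *v x) (f *v y))"

definition law_orbit ::
    "(complex^'n \<Rightarrow> complex^'n \<Rightarrow> complex^'n) \<Rightarrow> (complex^('n \<times> 'n \<times> 'n)) set" where
  "law_orbit \<phi> = {structure_constants (transport_law f \<phi>) | f. invertible f}"

inductive complex_polynomial_map :: "(complex^'m \<Rightarrow> complex) \<Rightarrow> bool" where
  const: "complex_polynomial_map (\<lambda>x. c)"
| coord: "complex_polynomial_map (\<lambda>x. x $ i)"
| add: "complex_polynomial_map p \<Longrightarrow> complex_polynomial_map q \<Longrightarrow> complex_polynomial_map (\<lambda>x. p x + q x)"
| mult: "complex_polynomial_map p \<Longrightarrow> complex_polynomial_map q \<Longrightarrow> complex_polynomial_map (\<lambda>x. p x * q x)"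

definition zero_locus :: "(complex^'m \<Rightarrow> complex) set \<Rightarrow> (complex^'m) set" where
  "zero_locus F = {x. \<forall>p\<in>F. p x = 0}"

definition zariski :: "(complex^'m) topology" where
  "zariski = topology (\<lambda>U. \<exists>F. (\<forall>p\<in>F. complex_polynomial_map p) \<and> U = - zero_locus F)"

lemma openin_zariski:
  fixes U :: "(complex^'m) set"
  shows "openin zariski U \<longleftrightarrow> (\<exists>F. (\<forall>p\<in>F. complex_polynomial_map p) \<and> U = - zero_locus F)"
proof -
  let ?P = "\<lambda>U::(complex^'m) set. \<exists>F. (\<forall>p\<in>F. complex_polynomial_map p) \<and> U = - zero_locus F"
  have "?P (S \<inter> T)" if "?P S" "?P T" for S T
  proof -
    from that obtain F G where F: "\<forall>p\<in>F. complex_polynomial_map p" "S = - zero_locus F"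
      and G: "\<forall>p\<in>G. complex_polynomial_map p" "T = - zero_locus G" by blast
    let ?H = "{\<lambda>x. p x * q x | p q. p \<in> F \<and> q \<in> G}"
    have "\<forall>p\<in>?H. complex_polynomial_map p"
      using F(1) G(1) by (auto intro: complex_polynomial_map.mult)
    moreover have "S \<inter> T = - zero_locus ?H"
    proof (rule set_eqI)
      fix x
      have "x \<in> S \<inter> T \<longleftrightarrow> (\<exists>p\<in>F. \<exists>q\<in>G. p x * q x \<noteq> 0)"
        by (auto simp: F(2) G(2) zero_locus_def)
      also have "\<dots> \<longleftrightarrow> x \<in> - zero_locus ?H"
        unfolding zero_locus_def by fastforce
      finally show "x \<in> S \<inter> T \<longleftrightarrow> x \<in> - zero_locus ?H" .
    qed
    ultimately show ?thesis by blast
  qed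
  moreover have "?P (\<Union>K)" if "\<forall>S\<in>K. ?P S" for K
  proof -
    from bchoice[OF that] obtain F where
      F: "\<forall>S\<in>K. (\<forall>p\<in>F S. complex_polynomial_map p) \<and> S = - zero_locus (F S)" by blast
    have "\<Union>K = - zero_locus (\<Union>S\<in>K. F S)"
    proof (rule set_eqI)
      fix x
      have "x \<in> S \<longleftrightarrow> (\<exists>p\<in>F S. p x \<noteq> 0)" if "S \<in> K" for S
        using F that unfolding zero_locus_def by blast
      then show "x \<in> \<Union>K \<longleftrightarrow> x \<in> - zero_locus (\<Union>S\<in>K. F S)"
        by (auto simp: zero_locus_def)
    qed
    moreover have "\<forall>p\<in>(\<Union>S\<in>K. F S). complex_polynomial_map p" using F by blast
    ultimately show ?thesis by blast
  qed
  ultimately have "istopology ?P"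
    unfolding istopology_def by blast
  then show ?thesis
    by (simp add: zariski_def topology_inverse')
qed

lemma topspace_zariski [simp]: "topspace (zariski :: (complex^'m) topology) = UNIV"
proof -
  have "zero_locus {\<lambda>x::complex^'m. 1} = {}" by (auto simp: zero_locus_def)
  then have "openin zariski (UNIV :: (complex^'m) set)"
    unfolding openin_zariski
    by (intro exI[of _ "{\<lambda>x. 1}"]) (auto intro: complex_polynomial_map.const)
  then show ?thesis by (metis openin_subset top.extremum_uniqueI)
qed

lemma closedin_zariski:
  "closedin zariski Z \<longleftrightarrow> (\<exists>F. (\<forall>p\<in>F. complex_polynomial_map p) \<and> Z = zero_locus F)"
  by (auto simp: closedin_def openin_zariski Compl_eq_Diff_UNIV[symmetric])

definition irreducible_space :: "'a topology \<Rightarrow> bool" where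
  "irreducible_space X \<longleftrightarrow>
     topspace X \<noteq> {} \<and>
     (\<forall>A B. closedin X A \<and> closedin X B \<and> topspace X = A \<union> B \<longrightarrow> A = topspace X \<or> B = topspace X)"

definition irreducible_components :: "'a topology \<Rightarrow> 'a set set" where
  "irreducible_components X =
     {S. S \<subseteq> topspace X \<and> irreducible_space (subtopology X S) \<and>
         (\<forall>T. T \<subseteq> topspace X \<and> irreducible_space (subtopology X T) \<and> S \<subseteq> T \<longrightarrow> T = S)}"

definition bilinear_extension :: "('n \<Rightarrow> 'n \<Rightarrow> complex^'n) \<Rightarrow> complex^'n \<Rightarrow> complex^'n \<Rightarrow> complex^'n" where
  "bilinear_extension t x y = (\<Sum>i\<in>UNIV. \<Sum>j\<in>UNIV. (x $ i * y $ j) *s t i j)"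

text \<open>The index type \<^typ>\<open>4\<close> has the four distinct elements 1, 2, 3 and 4 = 0.\<close>

definition phi1 :: "complex^4 \<Rightarrow> complex^4 \<Rightarrow> complex^4" where
  "phi1 = bilinear_extension (\<lambda>i j.
     if (i, j) = (1, 1) then axis 2 1
     else if (i, j) \<in> {(1, 2), (2, 1)} then axis 3 1
     else if (i, j) \<in> {(1, 3), (3, 1)} then axis 4 1
     else if (i, j) = (2, 2) then axis 4 1
     else 0)"

definition phi2 :: "complex^4 \<Rightarrow> complex^4 \<Rightarrow> complex^4" where
  "phi2 = bilinear_extension (\<lambda>i j.
     if (i, j) = (1, 1) then axis 2 1
     else if (i, j) \<in> {(1, 2), (2, 1)} then axis 3 1
     else if (i, j) = (4, 4) then axis 2 1
     else 0)"

end

theory Submission imports Defs "HOL-Computational_Algebra.Polynomial"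
begin

text \<open>
  A nilpotent commutative law has, by Engel's argument, a basis in which it is triangular: \<open>e\<^sub>i e\<^sub>j\<close> is
  a combination of the \<open>e\<^sub>k\<close> with \<open>k > max i j\<close> (\<open>nilpotent_law_triangular_basis\<close>). In dimension four such
  a law has ten coefficients, and evaluating the Jordan identity at a few vectors of the span of \<open>e\<^sub>1\<close>
  and \<open>e\<^sub>2\<close> leaves three types.

  First, an algebra generated by one element is isomorphic to \<open>phi1\<close>. Second, there is the family
  \<^emph>\<open>on two generators\<close> \<open>e\<^sub>1\<close>, \<open>e\<^sub>4\<close>, where the product of the generators is given by a quadratic form
  with values in the plane of \<open>e\<^sub>2\<close>, \<open>e\<^sub>3\<close>, and \<open>e\<^sub>2\<close> times a generator by a linear form with values in
  the line of \<open>e\<^sub>3\<close>. This family is a linear space containing \<open>phi2\<close>, and its generic member is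
  isomorphic to \<open>phi2\<close>; so the whole family lies in the closure of the orbit of \<open>phi2\<close>. Third, all
  products may lie in one line and be given by a quadratic form on three-dimensional space. Choosing a flag
  adapted to an isotropic vector exhibits such a law as a limit of algebras isomorphic to \<open>phi1\<close>.

  Being a limit is always tested along curves: a polynomial vanishing on an orbit vanishes along any
  polynomial curve whose generic point lies in the orbit (\<open>zariski_closure_along_curve\<close>). The same
  principle, for rational curves, shows that the orbit closures are irreducible, because two
  invertible matrices are joined by a line whose generic point is invertible
  (\<open>irreducible_orbit_closure\<close>).

  Conversely both closures consist of nilpotent Jordan laws, since the Jordan identity and, in dimension
  four, nilpotency are identities between products. Neither closure contains the other: laws in the
  first are associative, and laws in the second have vanishing products of four factors. Hence they
  are the irreducible components (\<open>irreducible_components_two\<close>).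
\<close>

section \<open>Zariski closure and rational curves\<close>

lemma zariski_closure_iff:
  "x \<in> zariski closure_of S \<longleftrightarrow>
     (\<forall>p. complex_polynomial_map p \<longrightarrow> (\<forall>y\<in>S. p y = 0) \<longrightarrow> p x = 0)"
proof
  assume x: "x \<in> zariski closure_of S"
  show "\<forall>p. complex_polynomial_map p \<longrightarrow> (\<forall>y\<in>S. p y = 0) \<longrightarrow> p x = 0"
  proof (intro allI impI)
    fix p assume p: "complex_polynomial_map p" "\<forall>y\<in>S. p y = 0"
    have "closedin zariski (zero_locus {p})"
      using p(1) unfolding closedin_zariski by blast
    moreover have "S \<subseteq> zero_locus {p}" using p(2) by (auto simp: zero_locus_def)
    ultimately have "zariski closure_of S \<subseteq> zero_locus {p}" by (metis closure_of_minimal)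
    with x show "p x = 0" by (auto simp: zero_locus_def)
  qed
next
  assume *: "\<forall>p. complex_polynomial_map p \<longrightarrow> (\<forall>y\<in>S. p y = 0) \<longrightarrow> p x = 0"
  obtain F where F: "\<forall>p\<in>F. complex_polynomial_map p" "zariski closure_of S = zero_locus F"
    using closedin_closure_of[of zariski S] unfolding closedin_zariski by blast
  have "S \<subseteq> zero_locus F" using closure_of_subset[of S zariski] F(2) by simp
  then have "\<forall>y\<in>S. p y = 0" if "p \<in> F" for p using that by (auto simp: zero_locus_def)
  then have "x \<in> zero_locus F" using * F(1) by (simp add: zero_locus_def)
  then show "x \<in> zariski closure_of S" by (simp add: F(2))
qed

text \<open>Polynomial functions of one parameter, kept as functions rather than as elements of
  \<^typ>\<open>complex poly\<close> so that curves can be written down by explicit formulas.\<close>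

definition poly_fun :: "(complex \<Rightarrow> complex) \<Rightarrow> bool" where
  "poly_fun h \<longleftrightarrow> (\<exists>u. \<forall>s. h s = poly u s)"

named_theorems poly_fun_intros

lemma poly_fun_const [poly_fun_intros]: "poly_fun (\<lambda>s. a)"
  unfolding poly_fun_def by (rule exI[of _ "[:a:]"]) simp

lemma poly_fun_id [poly_fun_intros]: "poly_fun (\<lambda>s. s)"
  unfolding poly_fun_def by (rule exI[of _ "[:0, 1:]"]) simp

lemma poly_fun_add [poly_fun_intros]: "poly_fun f \<Longrightarrow> poly_fun g \<Longrightarrow> poly_fun (\<lambda>s. f s + g s)"
  unfolding poly_fun_def by (metis poly_add)

lemma poly_fun_diff [poly_fun_intros]: "poly_fun f \<Longrightarrow> poly_fun g \<Longrightarrow> poly_fun (\<lambda>s. f s - g s)"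
  unfolding poly_fun_def by (metis poly_diff)

lemma poly_fun_mult [poly_fun_intros]: "poly_fun f \<Longrightarrow> poly_fun g \<Longrightarrow> poly_fun (\<lambda>s. f s * g s)"
  unfolding poly_fun_def by (metis poly_mult)

lemma poly_fun_power [poly_fun_intros]: "poly_fun f \<Longrightarrow> poly_fun (\<lambda>s. f s ^ n)"
  unfolding poly_fun_def by (metis poly_power)

lemma poly_fun_sum [poly_fun_intros]:
  "(\<And>i. i \<in> I \<Longrightarrow> poly_fun (f i)) \<Longrightarrow> poly_fun (\<lambda>s. \<Sum>i\<in>I. f i s)"
  by (induction I rule: infinite_finite_induct) (auto intro: poly_fun_intros)

lemma poly_fun_prod [poly_fun_intros]:
  "(\<And>i. i \<in> I \<Longrightarrow> poly_fun (f i)) \<Longrightarrow> poly_fun (\<lambda>s. \<Prod>i\<in>I. f i s)"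
  by (induction I rule: infinite_finite_induct) (auto intro: poly_fun_intros)

lemma poly_fun_det:
  fixes M :: "complex \<Rightarrow> complex^'n^'n"
  assumes "\<And>i j. poly_fun (\<lambda>s. M s $ i $ j)"
  shows "poly_fun (\<lambda>s. det (M s))"
  unfolding det_def by (intro poly_fun_intros assms)

lemma poly_fun_finite_zeros:
  assumes "poly_fun h" "h t \<noteq> 0"
  shows "finite {s. h s = 0}"
proof -
  obtain u where u: "\<And>s. h s = poly u s" using assms(1) unfolding poly_fun_def by blast
  with assms(2) have "u \<noteq> 0" by auto
  then show ?thesis using poly_roots_finite[of u] by (simp add: u)
qed

text \<open>Clearing denominators: when the coordinates of \<open>\<gamma>\<close> are fractions with the common denominator
  \<open>D\<close>, a polynomial in them becomes polynomial in the parameter after multiplication by a power of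
  \<open>D\<close>. The values of \<open>\<gamma>\<close> at the zeros of \<open>D\<close> are arbitrary.\<close>

lemma polynomial_map_along_rational_curve:
  fixes \<gamma> :: "complex \<Rightarrow> complex^'m"
  assumes "complex_polynomial_map p"
    and D: "poly_fun D"
    and \<gamma>: "\<And>i. \<exists>u. poly_fun u \<and> (\<forall>s. D s \<noteq> 0 \<longrightarrow> \<gamma> s $ i * D s = u s)"
  shows "\<exists>N u. poly_fun u \<and> (\<forall>s. D s \<noteq> 0 \<longrightarrow> p (\<gamma> s) * D s ^ N = u s)"
  using assms(1)
proof induction
  case (const c)
  show ?case by (intro exI[of _ 0] exI[of _ "\<lambda>s. c"]) (simp add: poly_fun_const)
next
  case (coord i)
  obtain u where "poly_fun u" "\<forall>s. D s \<noteq> 0 \<longrightarrow> \<gamma> s $ i * D s = u s" using \<gamma> by blast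
  then show ?case by (intro exI[of _ 1] exI[of _ u]) simp
next
  case (add p q)
  then obtain M u N v where
    u: "poly_fun u" "\<forall>s. D s \<noteq> 0 \<longrightarrow> p (\<gamma> s) * D s ^ M = u s" and
    v: "poly_fun v" "\<forall>s. D s \<noteq> 0 \<longrightarrow> q (\<gamma> s) * D s ^ N = v s" by blast
  show ?case
  proof (intro exI[of _ "M + N"] exI[of _ "\<lambda>s. u s * D s ^ N + v s * D s ^ M"] conjI allI impI)
    show "poly_fun (\<lambda>s. u s * D s ^ N + v s * D s ^ M)" by (intro poly_fun_intros u v D)
    fix s assume "D s \<noteq> 0"
    with u(2) v(2) have "u s = p (\<gamma> s) * D s ^ M" "v s = q (\<gamma> s) * D s ^ N" by auto
    then show "(p (\<gamma> s) + q (\<gamma> s)) * D s ^ (M + N) = u s * D s ^ N + v s * D s ^ M"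
      by (simp add: power_add algebra_simps)
  qed
next
  case (mult p q)
  then obtain M u N v where
    u: "poly_fun u" "\<forall>s. D s \<noteq> 0 \<longrightarrow> p (\<gamma> s) * D s ^ M = u s" and
    v: "poly_fun v" "\<forall>s. D s \<noteq> 0 \<longrightarrow> q (\<gamma> s) * D s ^ N = v s" by blast
  show ?case
  proof (intro exI[of _ "M + N"] exI[of _ "\<lambda>s. u s * v s"] conjI allI impI)
    show "poly_fun (\<lambda>s. u s * v s)" by (intro poly_fun_intros u v)
    fix s assume "D s \<noteq> 0"
    with u(2) v(2) have "u s = p (\<gamma> s) * D s ^ M" "v s = q (\<gamma> s) * D s ^ N" by auto
    then show "p (\<gamma> s) * q (\<gamma> s) * D s ^ (M + N) = u s * v s"
      by (simp add: power_add)
  qed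
qed

lemma finite_zeros_along_rational_curve:
  fixes \<gamma> :: "complex \<Rightarrow> complex^'m"
  assumes "complex_polynomial_map p"
    and D: "poly_fun D"
    and "\<And>i. \<exists>u. poly_fun u \<and> (\<forall>s. D s \<noteq> 0 \<longrightarrow> \<gamma> s $ i * D s = u s)"
    and t: "D t \<noteq> 0" "p (\<gamma> t) \<noteq> 0"
  shows "finite {s. D s = 0 \<or> p (\<gamma> s) = 0}"
proof -
  obtain N u where u: "poly_fun u" "\<forall>s. D s \<noteq> 0 \<longrightarrow> p (\<gamma> s) * D s ^ N = u s"
    using polynomial_map_along_rational_curve[OF assms(1-3)] by blast
  have "u t \<noteq> 0" using u(2) t by (metis mult_eq_0_iff power_not_zero)
  then have "finite ({s. D s = 0} \<union> {s. u s = 0})"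
    using poly_fun_finite_zeros[OF D t(1)] poly_fun_finite_zeros[OF u(1)] by blast
  moreover have "{s. D s = 0 \<or> p (\<gamma> s) = 0} \<subseteq> {s. D s = 0} \<union> {s. u s = 0}"
    using u(2) by force
  ultimately show ?thesis by (rule rev_finite_subset)
qed

text \<open>The degeneration principle behind every statement of the form ``this law is a limit of laws in
  the orbit'': a polynomial that vanishes on the orbit vanishes at all but finitely many points of the
  curve, hence at all of them.\<close>

lemma zariski_closure_along_curve:
  fixes \<gamma> :: "complex \<Rightarrow> complex^'m"
  assumes \<gamma>: "\<And>i. poly_fun (\<lambda>s. \<gamma> s $ i)"
    and E: "finite E" "\<And>s. s \<notin> E \<Longrightarrow> \<gamma> s \<in> S"
  shows "\<gamma> t \<in> zariski closure_of S"
  unfolding zariski_closure_iff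
proof (intro allI impI)
  fix p assume p: "complex_polynomial_map p" "\<forall>y\<in>S. p y = 0"
  show "p (\<gamma> t) = 0"
  proof (rule ccontr)
    assume "p (\<gamma> t) \<noteq> 0"
    then have "finite {s. (1::complex) = 0 \<or> p (\<gamma> s) = 0}"
      using \<gamma> by (intro finite_zeros_along_rational_curve[OF p(1), of "\<lambda>s. 1"])
        (auto intro: poly_fun_intros)
    moreover have "UNIV \<subseteq> E \<union> {s. (1::complex) = 0 \<or> p (\<gamma> s) = 0}" using E(2) p(2) by auto
    ultimately have "finite (UNIV :: complex set)"
      using E(1) finite_subset[of UNIV "E \<union> {s. (1::complex) = 0 \<or> p (\<gamma> s) = 0}"] by simp
    then show False by (simp add: infinite_UNIV_char_0)
  qed
qed

section \<open>Bilinear laws and their structure constants\<close>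

lemma cbilinear_iff:
  "cbilinear \<phi> \<longleftrightarrow>
     (\<forall>x y z. \<phi> x (y + z) = \<phi> x y + \<phi> x z) \<and> (\<forall>a x y. \<phi> x (a *s y) = a *s \<phi> x y) \<and>
     (\<forall>x y z. \<phi> (x + y) z = \<phi> x z + \<phi> y z) \<and> (\<forall>a x y. \<phi> (a *s x) y = a *s \<phi> x y)"
  unfolding cbilinear_def Vector_Spaces.linear_iff
  using vec.vector_space_axioms[where 'a=complex and 'b='a] by blast

lemma cbilinear_add:
  assumes "cbilinear \<phi>"
  shows "\<phi> x (y + z) = \<phi> x y + \<phi> x z" "\<phi> (x + y) z = \<phi> x z + \<phi> y z"
  using assms unfolding cbilinear_iff by blast+

lemma cbilinear_scale:
  assumes "cbilinear \<phi>"
  shows "\<phi> x (a *s y) = a *s \<phi> x y" "\<phi> (a *s x) y = a *s \<phi> x y"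
  using assms unfolding cbilinear_iff by blast+

lemma cbilinear_zero:
  assumes "cbilinear \<phi>"
  shows "\<phi> x 0 = 0" "\<phi> 0 y = 0"
  using cbilinear_scale[OF assms, where a=0] by (metis vector_smult_lzero)+

lemma cbilinear_sum:
  assumes "cbilinear \<phi>"
  shows "\<phi> x (\<Sum>i\<in>I. f i) = (\<Sum>i\<in>I. \<phi> x (f i))" "\<phi> (\<Sum>i\<in>I. f i) y = (\<Sum>i\<in>I. \<phi> (f i) y)"
  by (induction I rule: infinite_finite_induct)
    (auto simp: cbilinear_zero[OF assms] cbilinear_add[OF assms])

lemma cbilinear_eq_bilinear_extension:
  assumes "cbilinear \<phi>"
  shows "\<phi> = bilinear_extension (\<lambda>i j. \<phi> (axis i 1) (axis j 1))"
proof (intro ext)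
  fix x y :: "complex^'a"
  have "\<phi> x y = \<phi> (\<Sum>i\<in>UNIV. x $ i *s axis i 1) (\<Sum>j\<in>UNIV. y $ j *s axis j 1)"
    by (simp add: basis_expansion)
  also have "\<dots> = (\<Sum>i\<in>UNIV. \<Sum>j\<in>UNIV. (x $ i * y $ j) *s \<phi> (axis i 1) (axis j 1))"
    by (simp add: cbilinear_sum[OF assms] cbilinear_scale[OF assms] vec.scale_sum_right)
      (subst sum.swap, simp add: mult.commute)
  finally show "\<phi> x y = bilinear_extension (\<lambda>i j. \<phi> (axis i 1) (axis j 1)) x y"
    by (simp add: bilinear_extension_def)
qed

lemma cbilinear_bilinear_extension: "cbilinear (bilinear_extension t)"
  unfolding cbilinear_iff bilinear_extension_def
  by (simp add: algebra_simps sum.distrib vec.scale_left_distrib vec.scale_sum_right)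

lemma bilinear_extension_axis: "bilinear_extension t (axis i 1) (axis j 1) = t i j"
proof -
  have "bilinear_extension t (axis i 1) (axis j 1)
      = (\<Sum>k\<in>UNIV. \<Sum>l\<in>UNIV. if k = i \<and> l = j then t i j else 0)"
    unfolding bilinear_extension_def axis_def by (intro sum.cong) auto
  also have "\<dots> = (\<Sum>k\<in>UNIV. if k = i then t i j else 0)"
    by (intro sum.cong) auto
  finally show ?thesis by simp
qed

text \<open>The inverse of \<^const>\<open>structure_constants\<close> on bilinear laws.\<close>

definition law_of :: "complex^('n \<times> 'n \<times> 'n) \<Rightarrow> complex^'n \<Rightarrow> complex^'n \<Rightarrow> complex^'n" where
  "law_of c = bilinear_extension (\<lambda>i j. \<chi> k. c $ (i, j, k))"

lemma cbilinear_law_of: "cbilinear (law_of c)"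
  by (simp add: law_of_def cbilinear_bilinear_extension)

lemma law_of_structure_constants:
  assumes "cbilinear \<phi>"
  shows "law_of (structure_constants \<phi>) = \<phi>"
proof -
  have "(\<lambda>i j. \<chi> k. structure_constants \<phi> $ (i, j, k)) = (\<lambda>i j. \<phi> (axis i 1) (axis j 1))"
    by (intro ext) (simp add: structure_constants_def vec_eq_iff)
  then show ?thesis
    unfolding law_of_def using cbilinear_eq_bilinear_extension[OF assms] by simp
qed

lemma structure_constants_law_of: "structure_constants (law_of c) = c"
  by (simp add: structure_constants_def law_of_def bilinear_extension_axis vec_eq_iff split_paired_all)

lemma matrix_inv_apply:
  fixes P :: "complex^'n^'n"
  assumes "invertible P"
  shows "matrix_inv P *v (P *v x) = x" "P *v (matrix_inv P *v x) = x"
proof -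
  have "P ** matrix_inv P = mat 1 \<and> matrix_inv P ** P = mat 1"
    using assms unfolding invertible_def matrix_inv_def by (rule someI_ex)
  then show "matrix_inv P *v (P *v x) = x" "P *v (matrix_inv P *v x) = x"
    by (simp_all add: matrix_vector_mul_assoc)
qed

lemma invertible_matrix_inv:
  fixes P :: "complex^'n^'n"
  assumes "invertible P"
  shows "invertible (matrix_inv P)"
proof -
  have "P ** matrix_inv P = mat 1 \<and> matrix_inv P ** P = mat 1"
    using assms unfolding invertible_def matrix_inv_def by (rule someI_ex)
  then show ?thesis unfolding invertible_def by blast
qed

lemma transport_law_hom:
  assumes "invertible P"
  shows "\<phi> (P *v x) (P *v y) = P *v transport_law P \<phi> x y"
  by (simp add: transport_law_def matrix_inv_apply[OF assms])

lemma transport_law_eqI: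
  assumes "invertible P" and "\<And>x y. \<phi> (P *v x) (P *v y) = P *v \<psi> x y"
  shows "transport_law P \<phi> = \<psi>"
  by (intro ext) (simp add: transport_law_def matrix_inv_apply[OF assms(1)] assms(2))

lemma cbilinear_transport_law:
  assumes "cbilinear \<phi>"
  shows "cbilinear (transport_law P \<phi>)"
  using assms unfolding cbilinear_iff transport_law_def
  by (simp add: matrix_vector_right_distrib vec.scale)

lemma transport_law_comp:
  assumes "invertible P" "invertible Q"
  shows "transport_law P (transport_law Q \<phi>) = transport_law (Q ** P) \<phi>"
  using assms
  by (intro transport_law_eqI[symmetric] invertible_mult)
    (simp_all add: transport_law_hom flip: matrix_vector_mul_assoc)

lemma transport_law_inverse:
  assumes "invertible P"
  shows "transport_law (matrix_inv P) (transport_law P \<phi>) = \<phi>"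
  using assms by (intro transport_law_eqI invertible_matrix_inv)
    (simp_all add: transport_law_def matrix_inv_apply)

text \<open>Vectors that depend polynomially on a point of affine space. Any expression built from
  \<open>law_of c\<close> and constant vectors is of this kind, so every identity between products cuts out a
  Zariski closed set of laws, without expanding it in coordinates.\<close>

definition poly_vec :: "(complex^'m \<Rightarrow> complex^'n) \<Rightarrow> bool" where
  "poly_vec F \<longleftrightarrow> (\<forall>k. complex_polynomial_map (\<lambda>c. F c $ k))"

named_theorems poly_vec_intros

lemma complex_polynomial_map_sum:
  "(\<And>i. i \<in> I \<Longrightarrow> complex_polynomial_map (f i)) \<Longrightarrow> complex_polynomial_map (\<lambda>s. \<Sum>i\<in>I. f i s)"
  by (induction I rule: infinite_finite_induct) (auto intro: complex_polynomial_map.intros)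

lemma poly_vec_const [poly_vec_intros]: "poly_vec (\<lambda>c. x)"
  by (simp add: poly_vec_def complex_polynomial_map.const)

lemma poly_vec_diff [poly_vec_intros]:
  assumes "poly_vec F" "poly_vec G"
  shows "poly_vec (\<lambda>c. F c - G c)"
proof -
  have "complex_polynomial_map (\<lambda>c. F c $ k + (- 1) * G c $ k)" for k
    using assms unfolding poly_vec_def by (intro complex_polynomial_map.intros) auto
  then show ?thesis by (simp add: poly_vec_def)
qed

lemma poly_vec_law_of [poly_vec_intros]:
  assumes "poly_vec F" "poly_vec G"
  shows "poly_vec (\<lambda>c. law_of c (F c) (G c))"
  using assms unfolding poly_vec_def law_of_def bilinear_extension_def
  by (auto intro!: complex_polynomial_map_sum complex_polynomial_map.intros)

lemma poly_vec_matrix [poly_vec_intros]: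
  assumes "poly_vec F"
  shows "poly_vec (\<lambda>c. P *v F c)"
  using assms unfolding poly_vec_def matrix_vector_mult_def
  by (auto intro!: complex_polynomial_map_sum complex_polynomial_map.intros)

lemma zariski_closure_identity:
  assumes "poly_vec F" "\<And>c. c \<in> S \<Longrightarrow> F c = 0" "c \<in> zariski closure_of S"
  shows "F c = 0"
proof -
  have "F c $ k = 0" for k
    using assms unfolding zariski_closure_iff poly_vec_def by (metis zero_index)
  then show ?thesis by (simp add: vec_eq_iff)
qed

lemma complex_polynomial_map_compose:
  assumes "complex_polynomial_map p" "poly_vec F"
  shows "complex_polynomial_map (\<lambda>x. p (F x))"
  using assms(1)
  by induction (use assms(2) in \<open>auto simp: poly_vec_def intro: complex_polynomial_map.intros\<close>)

section \<open>Orbits\<close>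

lemma law_orbitI:
  assumes "invertible P"
  shows "structure_constants (transport_law P \<phi>) \<in> law_orbit \<phi>"
  using assms by (auto simp: law_orbit_def)

lemma self_in_law_orbit: "structure_constants \<phi> \<in> law_orbit \<phi>"
proof -
  have "transport_law (mat 1) \<phi> = \<phi>"
    by (intro transport_law_eqI) (simp_all add: invertible_def)
  then show ?thesis using law_orbitI[of "mat 1" \<phi>] by (simp add: invertible_def)
qed

lemma law_orbit_transport:
  assumes "invertible P" "cbilinear \<phi>" "c \<in> law_orbit \<phi>"
  shows "structure_constants (transport_law P (law_of c)) \<in> law_orbit \<phi>"
proof -
  obtain Q where Q: "invertible Q" "c = structure_constants (transport_law Q \<phi>)"
    using assms(3) by (auto simp: law_orbit_def)
  have "structure_constants (transport_law P (law_of c))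
      = structure_constants (transport_law (Q ** P) \<phi>)"
    using Q assms(1,2)
    by (simp add: law_of_structure_constants cbilinear_transport_law transport_law_comp)
  then show ?thesis using law_orbitI[of "Q ** P"] Q(1) assms(1) by (simp add: invertible_mult)
qed

text \<open>A change of basis acts on the structure constants by a polynomial map that preserves the orbit,
  so it also preserves the closure of the orbit.\<close>

lemma orbit_closure_transport:
  assumes P: "invertible P" and \<phi>: "cbilinear \<phi>" and "cbilinear \<psi>"
    and mem: "structure_constants \<psi> \<in> zariski closure_of law_orbit \<phi>"
  shows "structure_constants (transport_law P \<psi>) \<in> zariski closure_of law_orbit \<phi>"
  unfolding zariski_closure_iff
proof (intro allI impI)
  let ?F = "\<lambda>c. structure_constants (transport_law P (law_of c))"
  fix p assume p: "complex_polynomial_map p" "\<forall>y\<in>law_orbit \<phi>. p y = 0"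
  have "poly_vec (\<lambda>c. transport_law P (law_of c) x y)" for x y
    unfolding transport_law_def by (intro poly_vec_intros)
  then have "poly_vec ?F"
    by (simp add: poly_vec_def structure_constants_def split_paired_all)
  then have "complex_polynomial_map (\<lambda>c. p (?F c))"
    by (rule complex_polynomial_map_compose[OF p(1)])
  moreover have "\<forall>c\<in>law_orbit \<phi>. p (?F c) = 0"
    using law_orbit_transport[OF P \<phi>] p(2) by blast
  ultimately have "p (?F (structure_constants \<psi>)) = 0"
    using mem unfolding zariski_closure_iff by blast
  then show "p (structure_constants (transport_law P \<psi>)) = 0"
    by (simp add: law_of_structure_constants[OF assms(3)])
qed

lemma orbit_closure_iso:
  assumes "invertible P" "cbilinear \<phi>" "cbilinear \<psi>"
    and "\<And>x y. \<theta> (P *v x) (P *v y) = P *v \<psi> x y"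
    and "structure_constants \<psi> \<in> zariski closure_of law_orbit \<phi>"
  shows "structure_constants \<theta> \<in> zariski closure_of law_orbit \<phi>"
proof -
  have "transport_law P \<theta> = \<psi>" by (rule transport_law_eqI) (use assms in auto)
  then have "\<theta> = transport_law (matrix_inv P) \<psi>" using transport_law_inverse[OF assms(1)] by metis
  then show ?thesis
    using orbit_closure_transport[OF invertible_matrix_inv[OF assms(1)] assms(2,3,5)] by simp
qed

lemma matrix_inv_cramer:
  fixes P :: "complex^'n^'n"
  assumes "det P \<noteq> 0"
  shows "(matrix_inv P *v v) $ k * det P = det (\<chi> i j. if j = k then v $ i else P $ i $ j)"
proof -
  have "P *v (matrix_inv P *v v) = v"
    using assms by (simp add: matrix_inv_apply invertible_det_nz)
  then have "matrix_inv P *v v = (\<chi> k. det (\<chi> i j. if j = k then v $ i else P $ i $ j) / det P)"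
    using cramer[OF assms] by blast
  then show ?thesis using assms by (simp add: vec_eq_iff)
qed

text \<open>Suppose the closure were the union of two proper closed subsets. Then there are polynomials
  \<open>p\<close>, \<open>q\<close> vanishing on one of them each, and matrices \<open>P\<close>, \<open>Q\<close> at which they do not vanish
  along the orbit. On the line through \<open>P\<close> and \<open>Q\<close> the transported law is, by Cramer's rule, a
  rational curve with denominator the determinant; so at a generic point of this line the matrix is
  invertible and neither \<open>p\<close> nor \<open>q\<close> vanishes, although their product vanishes on the orbit.\<close>

lemma irreducible_orbit_closure:
  fixes \<phi> :: "complex^'n \<Rightarrow> complex^'n \<Rightarrow> complex^'n"
  assumes "cbilinear \<phi>"
  shows "irreducible_space (subtopology zariski (zariski closure_of law_orbit \<phi>))"
  unfolding irreducible_space_def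
proof (intro conjI allI impI)
  let ?C = "zariski closure_of law_orbit \<phi>"
  have sub: "law_orbit \<phi> \<subseteq> ?C" by (simp add: closure_of_subset)
  have top: "topspace (subtopology zariski ?C) = ?C" by simp
  show "topspace (subtopology zariski ?C) \<noteq> {}" using sub self_in_law_orbit unfolding top by blast
  fix A B
  assume AB: "closedin (subtopology zariski ?C) A \<and> closedin (subtopology zariski ?C) B \<and>
    topspace (subtopology zariski ?C) = A \<union> B"
  have cl: "closedin zariski A" "closedin zariski B" "?C = A \<union> B"
    using AB by (metis closedin_closed_subtopology closedin_closure_of, metis closedin_closed_subtopology closedin_closure_of, simp)
  have witness: "\<exists>p P. complex_polynomial_map p \<and> (\<forall>x\<in>Z. p x = 0) \<and> invertible P \<and>
      p (structure_constants (transport_law P \<phi>)) \<noteq> 0"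
    if Z: "closedin zariski Z" "Z \<subseteq> ?C" "Z \<noteq> ?C" for Z
  proof -
    obtain F where F: "\<forall>p\<in>F. complex_polynomial_map p" "Z = zero_locus F"
      using Z(1) unfolding closedin_zariski by blast
    (* A closed set containing the orbit contains its closure. *)
    have "\<not> law_orbit \<phi> \<subseteq> Z" using closure_of_minimal[OF _ Z(1)] Z(2,3) by blast
    then obtain P where P: "invertible P" "structure_constants (transport_law P \<phi>) \<notin> Z"
      by (auto simp: law_orbit_def)
    then obtain p where "p \<in> F" "p (structure_constants (transport_law P \<phi>)) \<noteq> 0"
      unfolding F(2) zero_locus_def by blast
    then show ?thesis using F P by (auto simp: zero_locus_def)
  qed
  show "A = topspace (subtopology zariski ?C) \<or> B = topspace (subtopology zariski ?C)"
  proof (rule ccontr)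
    assume "\<not> ?thesis"
    then have "A \<noteq> ?C" "B \<noteq> ?C" by auto
    then obtain p P q Q where
      p: "complex_polynomial_map p" "\<forall>x\<in>A. p x = 0" "invertible P"
        "p (structure_constants (transport_law P \<phi>)) \<noteq> 0" and
      q: "complex_polynomial_map q" "\<forall>x\<in>B. q x = 0" "invertible Q"
        "q (structure_constants (transport_law Q \<phi>)) \<noteq> 0"
      using witness[of A] witness[of B] cl by blast
    (* The line of matrices through P and Q, and its image in the orbit. *)
    define R where "R s = (\<chi> i j. (1 - s) * P $ i $ j + s * Q $ i $ j)" for s
    define D where "D s = det (R s)" for s
    define \<gamma> where "\<gamma> s = structure_constants (transport_law (R s) \<phi>)" for s
    have R: "R 0 = P" "R 1 = Q" by (simp_all add: R_def)
    have R_poly: "poly_fun (\<lambda>s. R s $ i $ j)" for i j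
      unfolding R_def by (auto intro!: poly_fun_intros)
    have D: "poly_fun D" unfolding D_def by (intro poly_fun_det R_poly)
    have \<gamma>: "\<exists>u. poly_fun u \<and> (\<forall>s. D s \<noteq> 0 \<longrightarrow> \<gamma> s $ ijk * D s = u s)" for ijk
    proof (cases ijk)
      case (fields i j k)
      let ?v = "\<lambda>s. \<phi> (R s *v axis i 1) (R s *v axis j 1)"
      let ?u = "\<lambda>s. det (\<chi> a b. if b = k then ?v s $ a else R s $ a $ b)"
      have "poly_fun (\<lambda>s. ?v s $ a)" for a
        by (subst cbilinear_eq_bilinear_extension[OF assms])
          (auto simp: bilinear_extension_def matrix_vector_mult_def
            intro!: poly_fun_intros R_poly)
      then have "poly_fun (\<lambda>s. if b = k then ?v s $ a else R s $ a $ b)" for a b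
        by (cases "b = k") (simp_all add: R_poly)
      then have "poly_fun ?u" by (intro poly_fun_det) simp
      moreover have "\<gamma> s $ ijk * D s = ?u s" if "D s \<noteq> 0" for s
        using matrix_inv_cramer[of "R s"] that
        by (simp add: fields \<gamma>_def D_def structure_constants_def transport_law_def)
      ultimately show ?thesis by blast
    qed
    have "finite {s. D s = 0 \<or> p (\<gamma> s) = 0}"
      using p R by (intro finite_zeros_along_rational_curve[OF p(1) D \<gamma>, of 0])
        (simp_all add: D_def \<gamma>_def invertible_det_nz)
    moreover have "finite {s. D s = 0 \<or> q (\<gamma> s) = 0}"
      using q R by (intro finite_zeros_along_rational_curve[OF q(1) D \<gamma>, of 1])
        (simp_all add: D_def \<gamma>_def invertible_det_nz)
    ultimately have "finite ({s. D s = 0 \<or> p (\<gamma> s) = 0} \<union> {s. D s = 0 \<or> q (\<gamma> s) = 0})" by blast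
    then obtain s where "s \<notin> {s. D s = 0 \<or> p (\<gamma> s) = 0} \<union> {s. D s = 0 \<or> q (\<gamma> s) = 0}"
      using ex_new_if_finite[OF infinite_UNIV_char_0] by blast
    then have s: "D s \<noteq> 0" "p (\<gamma> s) \<noteq> 0" "q (\<gamma> s) \<noteq> 0" by auto
    have "\<gamma> s \<in> law_orbit \<phi>" using s(1) by (auto simp: \<gamma>_def D_def invertible_det_nz intro: law_orbitI)
    then have "\<gamma> s \<in> A \<or> \<gamma> s \<in> B" using sub cl(3) by blast
    then show False using p(2) q(2) s by blast
  qed
qed

text \<open>An irreducible subset of the union is contained in \<open>A\<close> or in \<open>B\<close>, so these are the only candidates
  for maximal ones.\<close>

lemma irreducible_components_two:
  assumes top: "topspace X = A \<union> B"
    and cl: "closedin X A" "closedin X B"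
    and irr: "irreducible_space (subtopology X A)" "irreducible_space (subtopology X B)"
    and inc: "\<not> A \<subseteq> B" "\<not> B \<subseteq> A"
  shows "irreducible_components X = {A, B}"
proof -
  have dich: "S \<subseteq> A \<or> S \<subseteq> B"
    if S: "S \<subseteq> topspace X" "irreducible_space (subtopology X S)" for S
  proof -
    have "topspace (subtopology X S) = S" using S(1) by auto
    moreover have "closedin (subtopology X S) (A \<inter> S)" "closedin (subtopology X S) (B \<inter> S)"
      using cl unfolding closedin_subtopology by blast+
    moreover have "S = (A \<inter> S) \<union> (B \<inter> S)" using S(1) top by blast
    ultimately have "A \<inter> S = S \<or> B \<inter> S = S" using S(2) unfolding irreducible_space_def by metis
    then show ?thesis by blast
  qed
  have AB: "A \<subseteq> topspace X" "B \<subseteq> topspace X" using top by auto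
  show ?thesis
  proof (intro equalityI subsetI)
    fix S assume "S \<in> irreducible_components X"
    then have S: "S \<subseteq> topspace X" "irreducible_space (subtopology X S)"
      "\<And>T. T \<subseteq> topspace X \<Longrightarrow> irreducible_space (subtopology X T) \<Longrightarrow> S \<subseteq> T \<Longrightarrow> T = S"
      unfolding irreducible_components_def by blast+
    show "S \<in> {A, B}" using dich[OF S(1,2)] S(3)[OF AB(1) irr(1)] S(3)[OF AB(2) irr(2)] by blast
  next
    fix S assume "S \<in> {A, B}"
    moreover have "T = A" if "T \<subseteq> topspace X" "irreducible_space (subtopology X T)" "A \<subseteq> T" for T
      using dich[OF that(1,2)] that(3) inc by blast
    moreover have "T = B" if "T \<subseteq> topspace X" "irreducible_space (subtopology X T)" "B \<subseteq> T" for T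
      using dich[OF that(1,2)] that(3) inc by blast
    ultimately show "S \<in> irreducible_components X"
      unfolding irreducible_components_def using AB irr by blast
  qed
qed

section \<open>Nilpotency\<close>

text \<open>The elements \<open>x\<close> with \<open>(...((x y\<^sub>1) y\<^sub>2)...) y\<^sub>m = 0\<close> for all \<open>y\<^sub>1, ..., y\<^sub>m\<close>; the upper series
  that is dual to the descending \<^const>\<open>central_series\<close>.\<close>

primrec right_annihilator :: "(complex^'n \<Rightarrow> complex^'n \<Rightarrow> complex^'n) \<Rightarrow> nat \<Rightarrow> (complex^'n) set" where
  "right_annihilator \<phi> 0 = {0}"
| "right_annihilator \<phi> (Suc m) = {x. \<forall>y. \<phi> x y \<in> right_annihilator \<phi> m}"

lemma subspace_right_annihilator:
  assumes "cbilinear \<phi>"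
  shows "vec.subspace (right_annihilator \<phi> m)"
proof (induction m)
  case 0
  show ?case by (simp add: vec.subspace_def)
next
  case (Suc m)
  then show ?case
    by (simp add: vec.subspace_def cbilinear_zero[OF assms] cbilinear_add[OF assms]
        cbilinear_scale[OF assms])
qed

lemma central_series_eq_zero:
  assumes "cbilinear \<phi>" "right_annihilator \<phi> m = UNIV"
  shows "central_series \<phi> m = {0}"
proof -
  have "central_series \<phi> j \<subseteq> right_annihilator \<phi> (m - j)" if "j \<le> m" for j
    using that
  proof (induction j)
    case 0
    then show ?case using assms(2) by simp
  next
    case (Suc j)
    then have "central_series \<phi> j \<subseteq> right_annihilator \<phi> (Suc (m - Suc j))"
      by (simp add: Suc_diff_Suc)
    then have "{\<phi> x y | x y. x \<in> central_series \<phi> j} \<subseteq> right_annihilator \<phi> (m - Suc j)" by auto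
    then show ?case
      using vec.span_minimal[OF _ subspace_right_annihilator[OF assms(1)]] by simp
  qed
  from this[of m] have "central_series \<phi> m \<subseteq> {0}" by simp
  moreover have "0 \<in> central_series \<phi> m" by (cases m) (auto simp: vec.span_zero)
  ultimately show ?thesis by blast
qed

text \<open>Engel's argument: take \<open>z\<close> in the last term of the central series that is not contained in
  \<open>I\<close>. For \<open>I\<close> spanned by vectors found in the same way, adding \<open>z\<close> yields the next step of a flag
  adapted to the law.\<close>

lemma nilpotent_law_absorbed_vector:
  assumes "nilpotent_law \<phi>" "vec.subspace I" "I \<noteq> UNIV"
  obtains z where "z \<notin> I" "\<And>x. \<phi> z x \<in> I"
proof -
  obtain m where "central_series \<phi> m = {0}" using assms(1) unfolding nilpotent_law_def by blast
  then have ex: "central_series \<phi> m \<subseteq> I" using assms(2) by (simp add: vec.subspace_0)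
  define l where "l = (LEAST m. central_series \<phi> m \<subseteq> I)"
  have l: "central_series \<phi> l \<subseteq> I" unfolding l_def by (rule LeastI[of "\<lambda>m. central_series \<phi> m \<subseteq> I", OF ex])
  then have "l \<noteq> 0" using assms(3) by (cases l) auto
  then obtain k where k: "l = Suc k" by (cases l) auto
  then have "\<not> central_series \<phi> k \<subseteq> I" using not_less_Least[of k "\<lambda>m. central_series \<phi> m \<subseteq> I"] l_def by simp
  then obtain z where z: "z \<in> central_series \<phi> k" "z \<notin> I" by blast
  have "\<phi> z x \<in> central_series \<phi> l" for x using z(1) unfolding k by (auto intro: vec.span_base)
  then show thesis using that z(2) l by blast
qed

section \<open>Coordinates and families of laws in dimension four\<close>

definition vec4 :: "complex \<Rightarrow> complex \<Rightarrow> complex \<Rightarrow> complex \<Rightarrow> complex^4" where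
  "vec4 a b c d = (\<chi> i. if i = 1 then a else if i = 2 then b else if i = 3 then c else d)"

lemma vec4_nth [simp]:
  "vec4 a b c d $ 1 = a" "vec4 a b c d $ 2 = b" "vec4 a b c d $ 3 = c" "vec4 a b c d $ 4 = d"
  by (simp_all add: vec4_def)

definition basis_matrix :: "complex^4 \<Rightarrow> complex^4 \<Rightarrow> complex^4 \<Rightarrow> complex^4 \<Rightarrow> complex^4^4" where
  "basis_matrix u v w z =
     (\<chi> i j. if j = 1 then u $ i else if j = 2 then v $ i else if j = 3 then w $ i else z $ i)"

lemma basis_matrix_apply:
  "basis_matrix u v w z *v x = x $ 1 *s u + x $ 2 *s v + x $ 3 *s w + x $ 4 *s z"
  by (simp add: vec_eq_iff basis_matrix_def matrix_vector_mult_def sum_4 mult.commute)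

lemma invertibleI_kernel:
  fixes P :: "complex^'n^'n"
  assumes "\<And>x. P *v x = 0 \<Longrightarrow> x = 0"
  shows "invertible P"
  using assms matrix_left_invertible_ker[of P] by (simp add: invertible_left_inverse)

lemma law_orbit_iso:
  assumes "invertible P" "\<And>x y. \<theta> (P *v x) (P *v y) = P *v \<phi> x y"
  shows "structure_constants \<theta> \<in> law_orbit \<phi>"
proof -
  have "transport_law P \<theta> = \<phi>" by (rule transport_law_eqI) (use assms in auto)
  then have "\<theta> = transport_law (matrix_inv P) \<phi>" using transport_law_inverse[OF assms(1)] by metis
  then show ?thesis using law_orbitI[OF invertible_matrix_inv[OF assms(1)], of \<phi>] by simp
qed

text \<open>The commutative laws with \<open>e\<^sub>i e\<^sub>j\<close> in the span of the \<open>e\<^sub>k\<close> with \<open>k > max i j\<close>: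
  \<open>e\<^sub>1 e\<^sub>1 = a e\<^sub>2 + b e\<^sub>3 + c e\<^sub>4\<close>, \<open>e\<^sub>1 e\<^sub>2 = d e\<^sub>3 + e e\<^sub>4\<close>, \<open>e\<^sub>1 e\<^sub>3 = g e\<^sub>4\<close>,
  \<open>e\<^sub>2 e\<^sub>2 = h e\<^sub>3 + k e\<^sub>4\<close>, \<open>e\<^sub>2 e\<^sub>3 = m e\<^sub>4\<close>, \<open>e\<^sub>3 e\<^sub>3 = n e\<^sub>4\<close>.\<close>

definition triangular_law :: "complex \<Rightarrow> complex \<Rightarrow> complex \<Rightarrow> complex \<Rightarrow> complex \<Rightarrow> complex \<Rightarrow> complex \<Rightarrow>
    complex \<Rightarrow> complex \<Rightarrow> complex \<Rightarrow> complex^4 \<Rightarrow> complex^4 \<Rightarrow> complex^4" where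
  "triangular_law a b c d e g h k m n x y = vec4 0
     (a * (x $ 1 * y $ 1))
     (b * (x $ 1 * y $ 1) + d * (x $ 1 * y $ 2 + x $ 2 * y $ 1) + h * (x $ 2 * y $ 2))
     (c * (x $ 1 * y $ 1) + e * (x $ 1 * y $ 2 + x $ 2 * y $ 1) + g * (x $ 1 * y $ 3 + x $ 3 * y $ 1)
       + k * (x $ 2 * y $ 2) + m * (x $ 2 * y $ 3 + x $ 3 * y $ 2) + n * (x $ 3 * y $ 3))"

text \<open>For \<open>x\<close>, \<open>y\<close> in the span of \<open>e\<^sub>1\<close> and \<open>e\<^sub>4\<close> the product is \<open>q(x, y) e\<^sub>2 + r(x, y) e\<^sub>3\<close> with
  symmetric forms \<open>q\<close>, \<open>r\<close>, and \<open>x e\<^sub>2 = l(x) e\<^sub>3\<close> with a linear form \<open>l\<close>. The structure constants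
  are linear in the parameters, so these laws form a linear space; \<open>phi2\<close> is one of them.\<close>

definition two_generator_law :: "complex \<Rightarrow> complex \<Rightarrow> complex \<Rightarrow> complex \<Rightarrow> complex \<Rightarrow> complex \<Rightarrow>
    complex \<Rightarrow> complex \<Rightarrow> complex^4 \<Rightarrow> complex^4 \<Rightarrow> complex^4" where
  "two_generator_law q1 q2 q3 r1 r2 r3 l1 l4 x y = vec4 0
     (q1 * (x $ 1 * y $ 1) + q2 * (x $ 1 * y $ 4 + x $ 4 * y $ 1) + q3 * (x $ 4 * y $ 4))
     (r1 * (x $ 1 * y $ 1) + r2 * (x $ 1 * y $ 4 + x $ 4 * y $ 1) + r3 * (x $ 4 * y $ 4)
       + (l1 * x $ 1 + l4 * x $ 4) * y $ 2 + x $ 2 * (l1 * y $ 1 + l4 * y $ 4))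
     0"

lemma cbilinear_triangular_law: "cbilinear (triangular_law a b c d e g h k m n)"
  unfolding cbilinear_iff triangular_law_def vec_eq_iff forall_4 by (simp add: algebra_simps)

lemma cbilinear_two_generator_law: "cbilinear (two_generator_law q1 q2 q3 r1 r2 r3 l1 l4)"
  unfolding cbilinear_iff two_generator_law_def vec_eq_iff forall_4 by (simp add: algebra_simps)

lemma phi1_eq: "phi1 = triangular_law 1 0 0 1 0 1 0 1 0 0"
  by (intro ext)
    (simp add: phi1_def triangular_law_def bilinear_extension_def sum_4 vec_eq_iff forall_4 axis_def)

lemma phi2_eq: "phi2 = two_generator_law 1 0 1 0 0 0 1 0"
  by (intro ext)
    (simp add: phi2_def two_generator_law_def bilinear_extension_def sum_4 vec_eq_iff forall_4 axis_def)

lemma cbilinear_phi: "cbilinear phi1" "cbilinear phi2"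
  by (simp_all add: phi1_eq phi2_eq cbilinear_triangular_law cbilinear_two_generator_law)

lemmas coordinates = vec_eq_iff forall_4 basis_matrix_apply triangular_law_def two_generator_law_def

section \<open>Degenerations of the two model laws\<close>

text \<open>The new basis consists of the powers \<open>x\<close>, \<open>x\<^sup>2\<close>, \<open>x\<^sup>3\<close>, \<open>x\<^sup>4\<close> of \<open>x = e\<^sub>1\<close>; the condition on \<open>k\<close>
  says \<open>x\<^sup>2 x\<^sup>2 = x\<^sup>4\<close>.\<close>

lemma triangular_law_in_orbit_phi1:
  assumes nz: "a \<noteq> 0" "d \<noteq> 0" "g \<noteq> 0" and k: "a * k = d * g"
  shows "structure_constants (triangular_law a b c d e g 0 k 0 0) \<in> law_orbit phi1"
proof (rule law_orbit_iso)
  let ?P = "basis_matrix (vec4 1 0 0 0) (vec4 0 a b c) (vec4 0 0 (a * d) (a * e + b * g))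
    (vec4 0 0 0 (a * d * g))"
  show "invertible ?P"
    by (rule invertibleI_kernel) (use nz in \<open>auto simp: coordinates\<close>)
  fix x y :: "complex^4"
  have k': "k * (a * z) = d * (g * z)" for z using k by (metis mult.assoc mult.commute)
  show "triangular_law a b c d e g 0 k 0 0 (?P *v x) (?P *v y) = ?P *v phi1 x y"
    using k by (simp add: phi1_eq coordinates algebra_simps k')
qed

lemma poly_fun_triangular_law:
  assumes "poly_fun a" "poly_fun b" "poly_fun c" "poly_fun d" "poly_fun e"
    "poly_fun g" "poly_fun h" "poly_fun k" "poly_fun m" "poly_fun n"
  shows "poly_fun (\<lambda>s. structure_constants
    (triangular_law (a s) (b s) (c s) (d s) (e s) (g s) (h s) (k s) (m s) (n s)) $ ijk)"
proof (cases ijk)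
  case (fields i j l)
  then show ?thesis
    using exhaust_4[of l]
    by (auto simp: structure_constants_def triangular_law_def intro!: poly_fun_intros assms)
qed

lemma poly_fun_two_generator_law:
  assumes "poly_fun q1" "poly_fun q2" "poly_fun q3" "poly_fun r1" "poly_fun r2"
    "poly_fun r3" "poly_fun l1" "poly_fun l4"
  shows "poly_fun (\<lambda>s. structure_constants
    (two_generator_law (q1 s) (q2 s) (q3 s) (r1 s) (r2 s) (r3 s) (l1 s) (l4 s)) $ ijk)"
proof (cases ijk)
  case (fields i j l)
  then show ?thesis
    using exhaust_4[of l]
    by (auto simp: structure_constants_def two_generator_law_def intro!: poly_fun_intros assms)
qed

text \<open>A law whose products are given by a symmetric form with values in the line of \<open>e\<^sub>4\<close>, for which
  \<open>e\<^sub>3\<close> is isotropic and orthogonal to \<open>e\<^sub>2\<close>. Switching on \<open>e\<^sub>1 e\<^sub>1 = s (g + s) e\<^sub>2 + ...\<close> and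
  \<open>e\<^sub>1 e\<^sub>2 = s (k + s) e\<^sub>3 + ...\<close>, and shifting \<open>g\<close> and \<open>k\<close> by \<open>s\<close>, keeps the relation
  \<open>a k = d g\<close> that characterises the orbit of \<open>phi1\<close> and makes all factors nonzero for generic \<open>s\<close>.\<close>

lemma isotropic_form_law_in_closure_phi1:
  "structure_constants (triangular_law 0 0 c 0 e g 0 k 0 0) \<in> zariski closure_of law_orbit phi1"
proof -
  let ?\<gamma> = "\<lambda>s. structure_constants
    (triangular_law (s * (g + s)) 0 c (s * (k + s)) e (g + s) 0 (k + s) 0 0)"
  have "?\<gamma> 0 \<in> zariski closure_of law_orbit phi1"
  proof (rule zariski_closure_along_curve[where \<gamma> = ?\<gamma> and t = 0])
    show "poly_fun (\<lambda>s. ?\<gamma> s $ i)" for i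
      by (intro poly_fun_triangular_law poly_fun_intros)
    (* The zeros of a d g, where a = s (g + s), d = s (k + s) and g + s is the third factor. *)
    show "finite {0, - g, - k}" by simp
    show "?\<gamma> s \<in> law_orbit phi1" if "s \<notin> {0, - g, - k}" for s
      using that by (intro triangular_law_in_orbit_phi1) (auto simp: add_eq_0_iff2)
  qed
  then show ?thesis by simp
qed

text \<open>Over the complex numbers the plane of \<open>e\<^sub>2\<close>, \<open>e\<^sub>3\<close> contains an isotropic vector
  \<open>u = e\<^sub>2 + \<beta> e\<^sub>3\<close>, and the orthogonal complement of \<open>u\<close> contains a second vector independent of
  \<open>u\<close>. In a basis beginning with a complementary vector and ending with this pair and \<open>e\<^sub>4\<close> the form
  has the shape treated above.\<close>

lemma form_law_in_closure_phi1:
  assumes "n \<noteq> 0"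
  shows "structure_constants (triangular_law 0 0 c 0 e g 0 k m n) \<in> zariski closure_of law_orbit phi1"
proof -
  define \<beta> where "\<beta> = (csqrt (m\<^sup>2 - n * k) - m) / n"
  have "n * \<beta> + m = csqrt (m\<^sup>2 - n * k)" using assms by (simp add: \<beta>_def)
  then have "(n * \<beta> + m)\<^sup>2 = m\<^sup>2 - n * k" by simp
  then have "n * (k + 2 * \<beta> * m + \<beta>\<^sup>2 * n) = 0" by (simp add: power2_eq_square algebra_simps)
  then have "k + (2 * \<beta> * m + \<beta>\<^sup>2 * n) = 0" using assms by (simp add: add.assoc)
  then have k: "k = - (2 * \<beta> * m + \<beta>\<^sup>2 * n)" by (simp only: eq_neg_iff_add_eq_0)
  show ?thesis
  proof (cases "m + \<beta> * n = 0")
    case True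
    then have m: "m = - (\<beta> * n)" by (simp add: eq_neg_iff_add_eq_0)
    show ?thesis
    proof (rule orbit_closure_iso)
      (* Here e_3 itself is orthogonal to u. *)
      let ?P = "basis_matrix (vec4 1 0 0 0) (vec4 0 0 1 0) (vec4 0 1 \<beta> 0) (vec4 0 0 0 1)"
      show "invertible ?P" by (rule invertibleI_kernel) (auto simp: coordinates)
      show "structure_constants (triangular_law 0 0 c 0 g (e + \<beta> * g) 0 n 0 0)
          \<in> zariski closure_of law_orbit phi1"
        by (rule isotropic_form_law_in_closure_phi1)
      show "triangular_law 0 0 c 0 e g 0 k m n (?P *v x) (?P *v y) =
          ?P *v triangular_law 0 0 c 0 g (e + \<beta> * g) 0 n 0 0 x y" for x y
        by (simp add: coordinates k m power2_eq_square algebra_simps)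
    qed (rule cbilinear_phi cbilinear_triangular_law)+
  next
    case False
    define \<mu> where "\<mu> = m + \<beta> * n"
    define \<epsilon> where "\<epsilon> = e + \<beta> * g"
    have m: "m = \<mu> - \<beta> * n" and e: "e = \<epsilon> - \<beta> * g" by (simp_all add: \<mu>_def \<epsilon>_def)
    let ?k = "\<epsilon>\<^sup>2 * n - 2 * \<epsilon> * \<mu> * g + \<mu>\<^sup>2 * c"
    show ?thesis
    proof (rule orbit_closure_iso)
      (* The pairings of u with e_3 and e_1 are \<mu> and \<epsilon>, so \<epsilon> e_3 - \<mu> e_1 is orthogonal to u. *)
      let ?P = "basis_matrix (vec4 0 0 1 0) (vec4 (- \<mu>) 0 \<epsilon> 0) (vec4 0 1 \<beta> 0) (vec4 0 0 0 1)"
      show "invertible ?P"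
        by (rule invertibleI_kernel) (use False in \<open>auto simp: coordinates simp flip: \<mu>_def\<close>)
      show "structure_constants (triangular_law 0 0 n 0 (\<epsilon> * n - \<mu> * g) \<mu> 0 ?k 0 0)
          \<in> zariski closure_of law_orbit phi1"
        by (rule isotropic_form_law_in_closure_phi1)
      show "triangular_law 0 0 c 0 e g 0 k m n (?P *v x) (?P *v y) =
          ?P *v triangular_law 0 0 n 0 (\<epsilon> * n - \<mu> * g) \<mu> 0 ?k 0 0 x y" for x y
        by (simp add: coordinates k m e power2_eq_square algebra_simps)
    qed (rule cbilinear_phi cbilinear_triangular_law)+
  qed
qed

text \<open>A basis in which the law becomes \<open>phi2\<close>: \<open>x\<^sub>1 = p e\<^sub>1 + s e\<^sub>4\<close> and \<open>x\<^sub>4 = t e\<^sub>1 + v e\<^sub>4\<close> are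
  \<open>q\<close>-orthogonal of equal \<open>q\<close>-norm \<open>M\<close> with \<open>l(x\<^sub>4) = 0\<close>, and the corrections \<open>\<beta> e\<^sub>2\<close>, \<open>\<alpha> e\<^sub>2\<close> make
  the \<open>e\<^sub>3\<close>-components of \<open>x\<^sub>1 x\<^sub>1\<close> and \<open>x\<^sub>4 x\<^sub>4\<close> equal and that of \<open>x\<^sub>1 x\<^sub>4\<close> zero. The remaining two basis
  vectors are \<open>x\<^sub>1 x\<^sub>1 = M e\<^sub>2 + R e\<^sub>3\<close> and \<open>x\<^sub>1 (x\<^sub>1 x\<^sub>1) = N M e\<^sub>3\<close>.\<close>

lemma two_generator_law_adapted_basis:
  assumes nz: "M \<noteq> 0" "N \<noteq> 0"
    and q: "q1 * p * p + 2 * q2 * p * s + q3 * s * s = M"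
      "q1 * p * t + q2 * (p * v + s * t) + q3 * s * v = 0"
      "q1 * t * t + 2 * q2 * t * v + q3 * v * v = M"
    and l: "l1 * p + l4 * s = N" "l1 * t + l4 * v = 0"
    and r: "r1 * p * p + 2 * r2 * p * s + r3 * s * s + 2 * \<beta> * N = R"
      "r1 * p * t + r2 * (p * v + s * t) + r3 * s * v + \<alpha> * N = 0"
      "r1 * t * t + 2 * r2 * t * v + r3 * v * v = R"
  shows "structure_constants (two_generator_law q1 q2 q3 r1 r2 r3 l1 l4) \<in> law_orbit phi2"
proof (rule law_orbit_iso)
  let ?P = "basis_matrix (vec4 p \<beta> 0 s) (vec4 0 M R 0) (vec4 0 0 (N * M) 0) (vec4 t \<alpha> 0 v)"
  let ?\<theta> = "two_generator_law q1 q2 q3 r1 r2 r3 l1 l4"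
  have lin: "l1 * (x1 * p + x4 * t) + l4 * (x1 * s + x4 * v) = x1 * N" for x1 x4
  proof -
    have "l1 * (x1 * p + x4 * t) + l4 * (x1 * s + x4 * v) = x1 * (l1 * p + l4 * s) + x4 * (l1 * t + l4 * v)"
      by (simp add: algebra_simps)
    then show ?thesis by (simp add: l)
  qed
  show "invertible ?P"
  proof (rule invertibleI_kernel)
    fix x assume "?P *v x = 0"
    then have x: "x $ 1 * p + x $ 4 * t = 0" "x $ 1 * \<beta> + x $ 2 * M + x $ 4 * \<alpha> = 0"
      "x $ 2 * R + x $ 3 * (N * M) = 0" "x $ 1 * s + x $ 4 * v = 0"
      by (simp_all add: coordinates)
    have x1: "x $ 1 = 0" using lin[of "x $ 1" "x $ 4"] x nz by simp
    have "t \<noteq> 0 \<or> v \<noteq> 0" using q(3) nz by auto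
    then have x4: "x $ 4 = 0" using x x1 by auto
    then show "x = 0" using x x1 nz by (simp add: vec_eq_iff forall_4)
  qed
  fix x y :: "complex^4"
  have "?\<theta> (?P *v x) (?P *v y) $ 2 =
      x $ 1 * y $ 1 * (q1 * p * p + 2 * q2 * p * s + q3 * s * s)
      + (x $ 1 * y $ 4 + x $ 4 * y $ 1) * (q1 * p * t + q2 * (p * v + s * t) + q3 * s * v)
      + x $ 4 * y $ 4 * (q1 * t * t + 2 * q2 * t * v + q3 * v * v)"
    by (simp add: two_generator_law_def basis_matrix_apply algebra_simps)
  then have c2: "?\<theta> (?P *v x) (?P *v y) $ 2 = (?P *v phi2 x y) $ 2"
    by (simp only: q) (simp add: phi2_eq coordinates algebra_simps)
  have P: "(?P *v z) $ 1 = z $ 1 * p + z $ 4 * t" "(?P *v z) $ 4 = z $ 1 * s + z $ 4 * v"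
    "(?P *v z) $ 2 = z $ 1 * \<beta> + z $ 2 * M + z $ 4 * \<alpha>" for z
    by (simp_all add: basis_matrix_apply)
  have form: "r1 * ((x1 * p + x4 * t) * (y1 * p + y4 * t))
      + r2 * ((x1 * p + x4 * t) * (y1 * s + y4 * v) + (x1 * s + x4 * v) * (y1 * p + y4 * t))
      + r3 * ((x1 * s + x4 * v) * (y1 * s + y4 * v))
    = x1 * y1 * (r1 * p * p + 2 * r2 * p * s + r3 * s * s)
      + (x1 * y4 + x4 * y1) * (r1 * p * t + r2 * (p * v + s * t) + r3 * s * v)
      + x4 * y4 * (r1 * t * t + 2 * r2 * t * v + r3 * v * v)" for x1 x4 y1 y4
    by (simp add: algebra_simps)
  have "?\<theta> (?P *v x) (?P *v y) $ 3 =
      x $ 1 * y $ 1 * (r1 * p * p + 2 * r2 * p * s + r3 * s * s)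
      + (x $ 1 * y $ 4 + x $ 4 * y $ 1) * (r1 * p * t + r2 * (p * v + s * t) + r3 * s * v)
      + x $ 4 * y $ 4 * (r1 * t * t + 2 * r2 * t * v + r3 * v * v)
      + x $ 1 * N * (y $ 1 * \<beta> + y $ 2 * M + y $ 4 * \<alpha>)
      + (x $ 1 * \<beta> + x $ 2 * M + x $ 4 * \<alpha>) * (y $ 1 * N)"
    by (simp only: two_generator_law_def vec4_nth P lin form)
  also have "\<dots> = x $ 1 * y $ 1 * (r1 * p * p + 2 * r2 * p * s + r3 * s * s + 2 * \<beta> * N)
      + (x $ 1 * y $ 4 + x $ 4 * y $ 1) * (r1 * p * t + r2 * (p * v + s * t) + r3 * s * v + \<alpha> * N)
      + x $ 4 * y $ 4 * (r1 * t * t + 2 * r2 * t * v + r3 * v * v)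
      + N * M * (x $ 1 * y $ 2 + x $ 2 * y $ 1)"
    by (simp add: algebra_simps)
  finally have c3: "?\<theta> (?P *v x) (?P *v y) $ 3 = (?P *v phi2 x y) $ 3"
    by (simp only: r) (simp add: phi2_eq coordinates algebra_simps)
  have c14: "?\<theta> (?P *v x) (?P *v y) $ 1 = (?P *v phi2 x y) $ 1"
    "?\<theta> (?P *v x) (?P *v y) $ 4 = (?P *v phi2 x y) $ 4"
    by (simp_all add: phi2_eq coordinates)
  show "?\<theta> (?P *v x) (?P *v y) = ?P *v phi2 x y"
    unfolding vec_eq_iff forall_4 by (intro conjI c14 c2 c3)
qed

text \<open>The two conditions say that \<open>q\<close> is nondegenerate and that the kernel of \<open>l\<close> is not isotropic for
  \<open>q\<close>. Then \<open>x\<^sub>4\<close> is chosen in the kernel of \<open>l\<close> and \<open>x\<^sub>1\<close> orthogonal to it; the factor \<open>\<tau>\<close> with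
  \<open>\<tau>\<^sup>2 = det q\<close> adjusts the norm of \<open>x\<^sub>4\<close> to that of \<open>x\<^sub>1\<close>.\<close>

lemma two_generator_law_in_orbit_phi2:
  assumes "q1 * q3 - q2\<^sup>2 \<noteq> 0" "q1 * l4\<^sup>2 - 2 * q2 * l1 * l4 + q3 * l1\<^sup>2 \<noteq> 0"
  shows "structure_constants (two_generator_law q1 q2 q3 r1 r2 r3 l1 l4) \<in> law_orbit phi2"
proof -
  define \<Delta> where "\<Delta> = q1 * q3 - q2\<^sup>2"
  define N where "N = q1 * l4\<^sup>2 - 2 * q2 * l1 * l4 + q3 * l1\<^sup>2"
  define \<tau> where "\<tau> = csqrt \<Delta>"
  have \<tau>: "\<tau> * \<tau> = \<Delta>" using power2_csqrt[of \<Delta>] by (simp add: \<tau>_def power2_eq_square)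
  define p where "p = q3 * l1 - q2 * l4"
  define s where "s = q1 * l4 - q2 * l1"
  define t where "t = \<tau> * l4"
  define v where "v = - \<tau> * l1"
  define R where "R = r1 * t * t + 2 * r2 * t * v + r3 * v * v"
  define \<beta> where "\<beta> = (R - (r1 * p * p + 2 * r2 * p * s + r3 * s * s)) / (2 * N)"
  define \<alpha> where "\<alpha> = - (r1 * p * t + r2 * (p * v + s * t) + r3 * s * v) / N"
  have nz: "\<Delta> \<noteq> 0" "N \<noteq> 0" using assms by (simp_all add: \<Delta>_def N_def)
  show ?thesis
  proof (rule two_generator_law_adapted_basis[where M = "\<Delta> * N" and N = N and p = p and s = s
        and t = t and v = v and \<alpha> = \<alpha> and \<beta> = \<beta> and R = R])
    show "\<Delta> * N \<noteq> 0" "N \<noteq> 0" using nz by simp_all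
    show "q1 * p * p + 2 * q2 * p * s + q3 * s * s = \<Delta> * N"
      by (simp add: p_def s_def \<Delta>_def N_def power2_eq_square algebra_simps)
    show "q1 * p * t + q2 * (p * v + s * t) + q3 * s * v = 0"
      by (simp add: p_def s_def t_def v_def algebra_simps)
    have "q1 * t * t + 2 * q2 * t * v + q3 * v * v = \<tau> * \<tau> * N"
      by (simp add: t_def v_def N_def power2_eq_square algebra_simps)
    then show "q1 * t * t + 2 * q2 * t * v + q3 * v * v = \<Delta> * N" by (simp only: \<tau>)
    show "l1 * p + l4 * s = N"
      by (simp add: p_def s_def N_def power2_eq_square algebra_simps)
    show "l1 * t + l4 * v = 0" by (simp add: t_def v_def algebra_simps)
    show "r1 * p * p + 2 * r2 * p * s + r3 * s * s + 2 * \<beta> * N = R"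
      using nz by (simp add: \<beta>_def field_simps)
    show "r1 * p * t + r2 * (p * v + s * t) + r3 * s * v + \<alpha> * N = 0"
      using nz by (simp add: \<alpha>_def)
    show "r1 * t * t + 2 * r2 * t * v + r3 * v * v = R" by (simp add: R_def)
  qed
qed

text \<open>The line through the given law and \<open>phi2\<close> stays in the linear family, and the genericity condition
  is a polynomial in the parameter that does not vanish at \<open>phi2\<close>.\<close>

lemma two_generator_law_in_closure_phi2:
  "structure_constants (two_generator_law q1 q2 q3 r1 r2 r3 l1 l4)
     \<in> zariski closure_of law_orbit phi2"
proof -
  define L where "L a b s = (1 - s) * a + s * b" for a b s :: complex
  have L: "poly_fun (\<lambda>s. L a b s)" for a b unfolding L_def by (intro poly_fun_intros)
  let ?\<gamma> = "\<lambda>s. structure_constants (two_generator_law (L q1 1 s) (L q2 0 s) (L q3 1 s)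
    (L r1 0 s) (L r2 0 s) (L r3 0 s) (L l1 1 s) (L l4 0 s))"
  let ?D = "\<lambda>s. (L q1 1 s * L q3 1 s - (L q2 0 s)\<^sup>2) *
    (L q1 1 s * (L l4 0 s)\<^sup>2 - 2 * L q2 0 s * L l1 1 s * L l4 0 s + L q3 1 s * (L l1 1 s)\<^sup>2)"
  have "?\<gamma> 0 \<in> zariski closure_of law_orbit phi2"
  proof (rule zariski_closure_along_curve[where \<gamma> = ?\<gamma> and t = 0])
    show "poly_fun (\<lambda>s. ?\<gamma> s $ i)" for i
      by (intro poly_fun_two_generator_law L)
    have "poly_fun ?D" by (intro poly_fun_intros L)
    moreover have "?D 1 \<noteq> 0" by (simp add: L_def)
    ultimately show "finite {s. ?D s = 0}" by (rule poly_fun_finite_zeros)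
    show "?\<gamma> s \<in> law_orbit phi2" if "s \<notin> {s. ?D s = 0}" for s
      using that by (intro two_generator_law_in_orbit_phi2) auto
  qed
  then show ?thesis by (simp add: L_def)
qed

section \<open>Triangular bases\<close>

lemma jordan_law_transport_law:
  assumes "invertible P" "jordan_law \<phi>"
  shows "jordan_law (transport_law P \<phi>)"
  unfolding jordan_law_def
proof (intro conjI allI)
  show "cbilinear (transport_law P \<phi>)"
    using assms(2) by (simp add: jordan_law_def cbilinear_transport_law)
  fix x y
  show "transport_law P \<phi> x y = transport_law P \<phi> y x"
    using assms(2) unfolding jordan_law_def transport_law_def by metis
  show "transport_law P \<phi> (transport_law P \<phi> x x) (transport_law P \<phi> x y) =
      transport_law P \<phi> x (transport_law P \<phi> (transport_law P \<phi> x x) y)"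
    using assms(2) by (simp add: jordan_law_def transport_law_def matrix_inv_apply[OF assms(1)])
qed

text \<open>Starting from the zero space, Engel's argument gives \<open>z\<^sub>4\<close>, \<open>z\<^sub>3\<close>, \<open>z\<^sub>2\<close>, \<open>z\<^sub>1\<close> in this order, with
  \<open>z\<^sub>i x\<close> in the span of the later vectors for every \<open>x\<close>. By commutativity the product of \<open>z\<^sub>i\<close> and \<open>z\<^sub>j\<close>
  lies in the smaller of the two spans.\<close>

lemma nilpotent_law_triangular_basis:
  fixes \<phi> :: "complex^4 \<Rightarrow> complex^4 \<Rightarrow> complex^4"
  assumes bil: "cbilinear \<phi>" and sym: "\<And>x y. \<phi> x y = \<phi> y x" and nil: "nilpotent_law \<phi>"
  obtains P a b c d e g h k m n
  where "invertible P" "transport_law P \<phi> = triangular_law a b c d e g h k m n"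
proof -
  have step: "\<exists>z. z \<notin> vec.span S \<and> (\<forall>x. \<phi> z x \<in> vec.span S)"
    if "finite S" "card S < 4" for S :: "(complex^4) set"
  proof -
    have "vec.dim (UNIV :: (complex^4) set) = 4" unfolding vec_dim_card by simp
    then have "vec.span S \<noteq> UNIV"
      using vec.dim_le_card[of UNIV S] that by auto
    then show ?thesis
      using nilpotent_law_absorbed_vector[OF nil vec.subspace_span[of S]] by metis
  qed
  obtain z4 where z4: "z4 \<notin> vec.span {}" "\<And>x. \<phi> z4 x \<in> vec.span {}"
    using step[of "{}"] by auto
  obtain z3 where z3: "z3 \<notin> vec.span {z4}" "\<And>x. \<phi> z3 x \<in> vec.span {z4}"
    using step[of "{z4}"] by auto
  obtain z2 where z2: "z2 \<notin> vec.span {z3, z4}" "\<And>x. \<phi> z2 x \<in> vec.span {z3, z4}"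
    using step[of "{z3, z4}"] card_length[of "[z3, z4]"] by auto
  obtain z1 where z1: "z1 \<notin> vec.span {z2, z3, z4}" "\<And>x. \<phi> z1 x \<in> vec.span {z2, z3, z4}"
    using step[of "{z2, z3, z4}"] card_length[of "[z2, z3, z4]"] by auto
  have insert: "v \<in> vec.span (insert a S) \<longleftrightarrow> (\<exists>k. \<exists>w\<in>vec.span S. v = k *s a + w)"
    for v a :: "complex^4" and S
  proof -
    have "v - k *s a \<in> vec.span S \<longleftrightarrow> (\<exists>w\<in>vec.span S. v = k *s a + w)" for k
      by (metis add_diff_cancel_left' diff_add_cancel add.commute)
    then show ?thesis by (simp add: vec.span_breakdown_eq)
  qed
  have span1: "v \<in> vec.span {z4} \<longleftrightarrow> (\<exists>d. v = d *s z4)" for v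
    by (auto simp: vec.span_singleton)
  have span2: "v \<in> vec.span {z3, z4} \<longleftrightarrow> (\<exists>c d. v = c *s z3 + d *s z4)" for v
    unfolding insert[of v z3] Bex_def span1 by blast
  have span3: "v \<in> vec.span {z2, z3, z4} \<longleftrightarrow> (\<exists>b c d. v = b *s z2 + (c *s z3 + d *s z4))" for v
    unfolding insert[of v z2] Bex_def span2 by blast
  note span = span1 span2 span3
  define P where "P = basis_matrix z1 z2 z3 z4"
  have coeff: "a = 0" if "a *s z + v = 0" "z \<notin> vec.span S" "v \<in> vec.span S" for a z v S
  proof (rule ccontr)
    assume "a \<noteq> 0"
    have "a *s z = - v" using that(1) by (simp add: eq_neg_iff_add_eq_0)
    then have "inverse a *s (a *s z) \<in> vec.span S" using that(3) by (simp add: vec.span_neg vec.span_scale)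
    then show False using \<open>a \<noteq> 0\<close> that(2) by simp
  qed
  have P: "invertible P"
  proof (rule invertibleI_kernel)
    fix x assume "P *v x = 0"
    then have x: "x $ 1 *s z1 + (x $ 2 *s z2 + (x $ 3 *s z3 + (x $ 4 *s z4 + 0))) = 0"
      by (simp add: P_def basis_matrix_apply add.assoc)
    have x1: "x $ 1 = 0" by (rule coeff[OF x z1(1)]) (auto simp: span)
    have x2: "x $ 2 = 0" by (rule coeff[OF _ z2(1)]) (use x x1 in \<open>auto simp: span\<close>)
    have x3: "x $ 3 = 0" by (rule coeff[OF _ z3(1)]) (use x x1 x2 in \<open>auto simp: span\<close>)
    have x4: "x $ 4 = 0" by (rule coeff[OF _ z4(1)]) (use x x1 x2 x3 in \<open>auto simp: vec.span_zero\<close>)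
    show "x = 0" using x1 x2 x3 x4 by (simp add: vec_eq_iff forall_4)
  qed
  define \<theta> where "\<theta> = transport_law P \<phi>"
  define t where "t i j = \<theta> (axis i 1) (axis j 1)" for i j
  have \<theta>: "\<theta> = bilinear_extension t"
    unfolding t_def \<theta>_def
    by (intro cbilinear_eq_bilinear_extension cbilinear_transport_law bil)
  have Pt: "P *v t i j = \<phi> (P *v axis i 1) (P *v axis j 1)" for i j
    by (simp add: t_def \<theta>_def transport_law_hom[OF P])
  have axis: "P *v axis 1 1 = z1" "P *v axis 2 1 = z2" "P *v axis 3 1 = z3" "P *v axis 4 1 = z4"
    by (simp_all add: P_def basis_matrix_apply axis_def)
  have t: "t i j = v" if "P *v t i j = P *v v" for i j v
    using that by (metis matrix_inv_apply(1)[OF P])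
  have t1: "t 1 j $ 1 = 0" for j
  proof -
    obtain b c d where "P *v t 1 j = b *s z2 + (c *s z3 + d *s z4)"
      using z1(2) unfolding Pt axis span by blast
    then have "P *v t 1 j = P *v vec4 0 b c d" by (simp add: P_def basis_matrix_apply add.assoc)
    from t[OF this] show ?thesis by simp
  qed
  have t2: "t 2 j $ 1 = 0 \<and> t 2 j $ 2 = 0" for j
  proof -
    obtain c d where "P *v t 2 j = c *s z3 + d *s z4"
      using z2(2) unfolding Pt axis span by blast
    then have "P *v t 2 j = P *v vec4 0 0 c d" by (simp add: P_def basis_matrix_apply add.assoc)
    from t[OF this] show ?thesis by simp
  qed
  have t3: "t 3 j $ 1 = 0 \<and> t 3 j $ 2 = 0 \<and> t 3 j $ 3 = 0" for j
  proof -
    obtain d where "P *v t 3 j = d *s z4"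
      using z3(2) unfolding Pt axis span by blast
    then have "P *v t 3 j = P *v vec4 0 0 0 d" by (simp add: P_def basis_matrix_apply add.assoc)
    from t[OF this] show ?thesis by simp
  qed
  have t4: "t 4 j = 0" for j
    using z4(2) Pt[of 4 j] t[of 4 j 0] by (simp add: axis)
  have tsym: "t i j = t j i" for i j
    using sym by (simp add: t_def \<theta>_def transport_law_def)
  have t4': "t i 4 = 0" for i by (simp add: tsym[of i 4] t4)
  have t_low: "t 1 2 $ 2 = 0" "t 1 3 $ 2 = 0" "t 1 3 $ 3 = 0" "t 2 3 $ 3 = 0"
    using t2[of 1] t3[of 1] t3[of 2] by (simp_all add: tsym[of 1 2] tsym[of 1 3] tsym[of 2 3])
  have "\<theta> = triangular_law (t 1 1 $ 2) (t 1 1 $ 3) (t 1 1 $ 4) (t 1 2 $ 3) (t 1 2 $ 4) (t 1 3 $ 4)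
      (t 2 2 $ 3) (t 2 2 $ 4) (t 2 3 $ 4) (t 3 3 $ 4)"
    unfolding \<theta>
    by (intro ext)
      (simp add: bilinear_extension_def coordinates sum_4 t1 t2 t3 t4 t_low
        t4' tsym[of 2 1] tsym[of 3 1] tsym[of 3 2] algebra_simps)
  then show thesis using that[OF P] by (simp add: \<theta>_def)
qed

section \<open>Every nilpotent Jordan law lies in one of the two closures\<close>

abbreviation "in_closures \<phi> \<equiv> structure_constants \<phi> \<in> zariski closure_of law_orbit phi1 \<union>
  zariski closure_of law_orbit phi2"

lemma orbit_closures_iso:
  assumes "invertible P" "cbilinear \<psi>" "\<And>x y. \<theta> (P *v x) (P *v y) = P *v \<psi> x y"
    and "in_closures \<psi>"
  shows "in_closures \<theta>"
  using assms orbit_closure_iso[OF assms(1) _ assms(2,3)] cbilinear_phi by blast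

text \<open>The Jordan identity at \<open>x = y = e\<^sub>1\<close> gives \<open>h = 0\<close> and \<open>k = d g\<close>; at \<open>x = e\<^sub>1 \<plusminus> e\<^sub>2\<close>,
  \<open>y = e\<^sub>1\<close> it gives \<open>d m = 0\<close> and \<open>d\<^sup>2 n = 0\<close>. If \<open>d = 0\<close> the law has generators \<open>e\<^sub>1\<close>, \<open>e\<^sub>3\<close> with
  \<open>e\<^sub>1 e\<^sub>1 = e\<^sub>2\<close> and all other products in the line of \<open>e\<^sub>4\<close>; if \<open>d \<noteq> 0\<close> and \<open>g = 0\<close> it has generators
  \<open>e\<^sub>1\<close>, \<open>e\<^sub>4\<close>; and if \<open>d g \<noteq> 0\<close> it is generated by \<open>e\<^sub>1\<close> and isomorphic to \<open>phi1\<close>.\<close>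

lemma triangular_jordan_a_nonzero_normalised:
  assumes J: "jordan_law (triangular_law 1 0 0 d e g h k m n)"
  shows "in_closures (triangular_law 1 0 0 d e g h k m n)"
proof -
  let ?\<theta> = "triangular_law 1 0 0 d e g h k m n"
  have J: "?\<theta> (?\<theta> x x) (?\<theta> x y) = ?\<theta> x (?\<theta> (?\<theta> x x) y)" for x y
    using J by (simp add: jordan_law_def)
  have h: "h = 0" and k: "k = d * g"
    using J[of "vec4 1 0 0 0" "vec4 1 0 0 0"] by (simp_all add: coordinates)
  have "2 * (d * m + d * d * n) = 0"
    using J[of "vec4 1 1 0 0" "vec4 1 0 0 0"] by (simp add: coordinates h k algebra_simps)
  then have sum: "d * m + d * d * n = 0" by (simp only: mult_eq_0_iff) simp
  have "2 * (d * d * n - d * m) = 0"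
    using J[of "vec4 1 (- 1) 0 0" "vec4 1 0 0 0"] by (simp add: coordinates h k algebra_simps)
  then have diff: "d * d * n = d * m" by (simp only: mult_eq_0_iff) simp
  have "2 * (d * m) = 0" using sum unfolding diff by simp
  then have dm: "d * m = 0" by simp
  moreover have "d * d * n = 0" unfolding diff by (rule dm)
  ultimately have mn: "d = 0 \<or> m = 0 \<and> n = 0" by auto
  show ?thesis
  proof (cases "d = 0")
    case True
    show ?thesis
    proof (rule orbit_closures_iso)
      let ?P = "basis_matrix (vec4 1 0 0 0) (vec4 0 1 0 0) (vec4 0 0 0 1) (vec4 0 0 1 0)"
      show "invertible ?P" by (rule invertibleI_kernel) (auto simp: coordinates)
      show "?\<theta> (?P *v x) (?P *v y) = ?P *v two_generator_law 1 0 0 0 g n e m x y" for x y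
        by (simp add: coordinates h k True algebra_simps)
    qed (simp_all add: two_generator_law_in_closure_phi2 cbilinear_two_generator_law)
  next
    case d: False
    then have mn: "m = 0" "n = 0" using mn by auto
    show ?thesis
    proof (cases "g = 0")
      case True
      show ?thesis
      proof (rule orbit_closures_iso)
        (* The third vector is e_1 e_2 = d e_3 + e e_4, and e_4 annihilates everything. *)
        let ?P = "basis_matrix (vec4 1 0 0 0) (vec4 0 1 0 0) (vec4 0 0 d e) (vec4 0 0 0 1)"
        show "invertible ?P" by (rule invertibleI_kernel) (use d in \<open>auto simp: coordinates\<close>)
        show "?\<theta> (?P *v x) (?P *v y) = ?P *v two_generator_law 1 0 0 0 0 0 1 0 x y" for x y
          by (simp add: coordinates h k mn True algebra_simps)
      qed (simp_all add: two_generator_law_in_closure_phi2 cbilinear_two_generator_law)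
    next
      case False
      then have "structure_constants ?\<theta> \<in> law_orbit phi1"
        using triangular_law_in_orbit_phi1[of 1 d g k 0 0 e] d by (simp add: h k mn)
      then show ?thesis using closure_of_subset[of "law_orbit phi1" zariski] by auto
    qed
  qed
qed

text \<open>Replacing \<open>e\<^sub>2\<close> by \<open>e\<^sub>1 e\<^sub>1\<close> reduces to \<open>a = 1\<close>, \<open>b = c = 0\<close>.\<close>

lemma triangular_jordan_a_nonzero:
  assumes a: "a \<noteq> 0" and J: "jordan_law (triangular_law a b c d e g h k m n)"
  shows "in_closures (triangular_law a b c d e g h k m n)"
proof -
  let ?\<theta> = "triangular_law a b c d e g h k m n"
  let ?\<psi> = "triangular_law 1 0 0 (a * d) (a * e + b * g) g (a\<^sup>2 * h)
    (a\<^sup>2 * k + 2 * a * b * m + b\<^sup>2 * n) (a * m + b * n) n"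
  let ?P = "basis_matrix (vec4 1 0 0 0) (vec4 0 a b c) (vec4 0 0 1 0) (vec4 0 0 0 1)"
  have P: "invertible ?P" by (rule invertibleI_kernel) (use a in \<open>auto simp: coordinates\<close>)
  have hom: "?\<theta> (?P *v x) (?P *v y) = ?P *v ?\<psi> x y" for x y
    by (simp add: coordinates power2_eq_square algebra_simps)
  have "jordan_law ?\<psi>"
    using jordan_law_transport_law[OF P J] transport_law_eqI[of ?P ?\<theta> ?\<psi>, OF P hom] by simp
  then show ?thesis
    by (intro orbit_closures_iso[of ?P ?\<psi> ?\<theta>, OF P cbilinear_triangular_law hom]
        triangular_jordan_a_nonzero_normalised)
qed

text \<open>If \<open>e\<^sub>3 e\<^sub>3 = 0\<close>, the law has generators \<open>e\<^sub>1\<close>, \<open>e\<^sub>2\<close> in the sense of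
  \<^const>\<open>two_generator_law\<close>. Otherwise the Jordan identity for \<open>x = y\<close> says that the
  \<open>e\<^sub>3\<close>-component of \<open>x x\<close> vanishes for all \<open>x\<close> in the span of \<open>e\<^sub>1\<close>, \<open>e\<^sub>2\<close>, so all products lie in the
  line of \<open>e\<^sub>4\<close>.\<close>

lemma triangular_jordan_a_zero:
  assumes J: "jordan_law (triangular_law 0 b c d e g h k m n)"
  shows "in_closures (triangular_law 0 b c d e g h k m n)"
proof (cases "n = 0")
  let ?\<theta> = "triangular_law 0 b c d e g h k m n"
  case True
  show ?thesis
  proof (rule orbit_closures_iso)
    let ?P = "basis_matrix (vec4 1 0 0 0) (vec4 0 0 1 0) (vec4 0 0 0 1) (vec4 0 1 0 0)"
    show "invertible ?P" by (rule invertibleI_kernel) (auto simp: coordinates)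
    show "?\<theta> (?P *v x) (?P *v y) = ?P *v two_generator_law b d h c e k g m x y" for x y
      by (simp add: coordinates True algebra_simps)
  qed (simp_all add: two_generator_law_in_closure_phi2 cbilinear_two_generator_law)
next
  let ?\<theta> = "triangular_law 0 b c d e g h k m n"
  case False
  have J: "?\<theta> (?\<theta> x x) (?\<theta> x y) = ?\<theta> x (?\<theta> (?\<theta> x x) y)" for x y
    using J by (simp add: jordan_law_def)
  (* The e_4-component of (x x)(x x) is n times the square of the e_3-component of x x, and x (x (x x)) = 0. *)
  have b: "b = 0"
    using J[of "vec4 1 0 0 0" "vec4 1 0 0 0"] False by (simp add: coordinates)
  have h: "h = 0"
    using J[of "vec4 0 1 0 0" "vec4 0 1 0 0"] False by (simp add: coordinates)
  have d: "d = 0"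
    using J[of "vec4 1 1 0 0" "vec4 1 1 0 0"] False by (simp add: coordinates b h)
  show ?thesis using form_law_in_closure_phi1[OF False, of c e g k m] by (simp add: b h d)
qed

lemma nilpotent_jordan_in_closures:
  fixes \<phi> :: "complex^4 \<Rightarrow> complex^4 \<Rightarrow> complex^4"
  assumes "jordan_law \<phi>" "nilpotent_law \<phi>"
  shows "in_closures \<phi>"
proof -
  obtain P a b c d e g h k m n
    where P: "invertible P" "transport_law P \<phi> = triangular_law a b c d e g h k m n"
    using nilpotent_law_triangular_basis[of \<phi>] assms unfolding jordan_law_def by metis
  have "jordan_law (triangular_law a b c d e g h k m n)"
    using jordan_law_transport_law[OF P(1) assms(1)] P(2) by simp
  then have "in_closures (triangular_law a b c d e g h k m n)"
    using triangular_jordan_a_nonzero triangular_jordan_a_zero by (cases "a = 0") simp_all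
  then show ?thesis
    by (rule orbit_closures_iso[OF P(1) cbilinear_triangular_law, rotated])
      (simp add: transport_law_hom[OF P(1)] P(2))
qed

section \<open>The variety is closed, and the closures are incomparable\<close>

text \<open>In dimension four nilpotency is a polynomial condition of fixed length, which makes the
  variety Zariski closed.\<close>

lemma nilpotent_law_iff:
  fixes \<phi> :: "complex^4 \<Rightarrow> complex^4 \<Rightarrow> complex^4"
  assumes bil: "cbilinear \<phi>" and sym: "\<And>x y. \<phi> x y = \<phi> y x"
  shows "nilpotent_law \<phi> \<longleftrightarrow> (\<forall>x y z u v. \<phi> (\<phi> (\<phi> (\<phi> x y) z) u) v = 0)"
proof
  assume "nilpotent_law \<phi>"
  then obtain P a b c d e g h k m n
    where P: "invertible P" "transport_law P \<phi> = triangular_law a b c d e g h k m n"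
    using nilpotent_law_triangular_basis[OF bil sym] by metis
  define \<theta> where "\<theta> = triangular_law a b c d e g h k m n"
  have "\<phi> = transport_law (matrix_inv P) \<theta>"
    using transport_law_inverse[OF P(1)] P(2) \<theta>_def by metis
  then have hom: "\<phi> (P *v x) (P *v y) = P *v \<theta> x y" for x y
    using transport_law_hom[OF P(1)] P(2) \<theta>_def by metis
  have "\<theta> (\<theta> (\<theta> (\<theta> x y) z) u) v = 0" for x y z u v
    by (simp add: \<theta>_def coordinates)
  then have "\<phi> (\<phi> (\<phi> (\<phi> (P *v x) (P *v y)) (P *v z)) (P *v u)) (P *v v) = 0" for x y z u v
    by (simp add: hom)
  then show "\<forall>x y z u v. \<phi> (\<phi> (\<phi> (\<phi> x y) z) u) v = 0"
    by (metis matrix_inv_apply(2)[OF P(1)])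
next
  assume "\<forall>x y z u v. \<phi> (\<phi> (\<phi> (\<phi> x y) z) u) v = 0"
  then have "right_annihilator \<phi> 4 = UNIV" by (simp add: numeral_eq_Suc)
  then show "nilpotent_law \<phi>"
    using central_series_eq_zero[OF bil] unfolding nilpotent_law_def by blast
qed

lemma nilpotent_jordan_variety_iff:
  "c \<in> nilpotent_jordan_variety \<longleftrightarrow> jordan_law (law_of c) \<and> nilpotent_law (law_of c)"
proof
  assume "c \<in> nilpotent_jordan_variety"
  then show "jordan_law (law_of c) \<and> nilpotent_law (law_of c)"
    by (auto simp: nilpotent_jordan_variety_def jordan_law_def law_of_structure_constants)
next
  assume "jordan_law (law_of c) \<and> nilpotent_law (law_of c)"
  then show "c \<in> nilpotent_jordan_variety"
    unfolding nilpotent_jordan_variety_def using structure_constants_law_of[of c] by (metis (mono_tags, lifting) mem_Collect_eq)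
qed

text \<open>The laws of the variety are characterised by identities between products, and these are
  invariant under change of basis and pass to the closure.\<close>

lemma orbit_closure_subset_variety:
  fixes \<phi> :: "complex^4 \<Rightarrow> complex^4 \<Rightarrow> complex^4"
  assumes J: "jordan_law \<phi>" and N: "\<And>x y z u v. \<phi> (\<phi> (\<phi> (\<phi> x y) z) u) v = 0"
  shows "zariski closure_of law_orbit \<phi> \<subseteq> nilpotent_jordan_variety"
proof
  fix c assume c: "c \<in> zariski closure_of law_orbit \<phi>"
  have bil: "cbilinear \<phi>" using J by (simp add: jordan_law_def)
  have orbit: "jordan_law (law_of c')"
    "law_of c' (law_of c' (law_of c' (law_of c' x y) z) u) v = 0"
    if "c' \<in> law_orbit \<phi>" for c' x y z u v
  proof -
    obtain P where P: "invertible P" "c' = structure_constants (transport_law P \<phi>)"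
      using \<open>c' \<in> law_orbit \<phi>\<close> by (auto simp: law_orbit_def)
    then have law: "law_of c' = transport_law P \<phi>"
      by (simp add: law_of_structure_constants cbilinear_transport_law bil)
    show "jordan_law (law_of c')" unfolding law by (rule jordan_law_transport_law[OF P(1) J])
    show "law_of c' (law_of c' (law_of c' (law_of c' x y) z) u) v = 0"
      by (simp add: law transport_law_def matrix_inv_apply[OF P(1)] N)
  qed
  have sym: "law_of c x y = law_of c y x" for x y
  proof -
    have "law_of c x y - law_of c y x = 0"
    proof (rule zariski_closure_identity[OF _ _ c])
      show "poly_vec (\<lambda>c. law_of c x y - law_of c y x)" by (intro poly_vec_intros)
      show "law_of c' x y - law_of c' y x = 0" if "c' \<in> law_orbit \<phi>" for c'
        using orbit(1)[OF that] unfolding jordan_law_def by (metis diff_self)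
    qed
    then show ?thesis by simp
  qed
  have jord: "law_of c (law_of c x x) (law_of c x y) = law_of c x (law_of c (law_of c x x) y)" for x y
  proof -
    have "law_of c (law_of c x x) (law_of c x y) - law_of c x (law_of c (law_of c x x) y) = 0"
    proof (rule zariski_closure_identity[OF _ _ c])
      show "poly_vec (\<lambda>c. law_of c (law_of c x x) (law_of c x y) - law_of c x (law_of c (law_of c x x) y))"
        by (intro poly_vec_intros)
      show "law_of c' (law_of c' x x) (law_of c' x y) - law_of c' x (law_of c' (law_of c' x x) y) = 0"
        if "c' \<in> law_orbit \<phi>" for c'
        using orbit(1)[OF that] unfolding jordan_law_def by simp
    qed
    then show ?thesis by simp
  qed
  have nil: "law_of c (law_of c (law_of c (law_of c x y) z) u) v = 0" for x y z u v
  proof (rule zariski_closure_identity[OF _ _ c])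
    show "poly_vec (\<lambda>c. law_of c (law_of c (law_of c (law_of c x y) z) u) v)"
      by (intro poly_vec_intros)
  qed (rule orbit(2))
  have "jordan_law (law_of c)" unfolding jordan_law_def
    by (intro conjI allI cbilinear_law_of sym jord)
  moreover have "nilpotent_law (law_of c)"
    unfolding nilpotent_law_iff[OF cbilinear_law_of sym] using nil by blast
  ultimately show "c \<in> nilpotent_jordan_variety" by (simp add: nilpotent_jordan_variety_iff)
qed

lemma law_orbit_law_of:
  assumes "cbilinear \<phi>" "c \<in> law_orbit \<phi>"
  obtains P where "invertible P" "law_of c = transport_law P \<phi>"
  using assms by (auto simp: law_orbit_def law_of_structure_constants cbilinear_transport_law)

text \<open>Associativity is a closed condition that holds for \<open>phi1\<close>, whereas
  \<open>e\<^sub>1 (e\<^sub>4 e\<^sub>4) = e\<^sub>3\<close> and \<open>(e\<^sub>1 e\<^sub>4) e\<^sub>4 = 0\<close> for \<open>phi2\<close>.\<close>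

lemma phi2_not_in_closure_phi1: "structure_constants phi2 \<notin> zariski closure_of law_orbit phi1"
proof
  assume mem: "structure_constants phi2 \<in> zariski closure_of law_orbit phi1"
  let ?x = "vec4 1 0 0 0" and ?z = "vec4 0 0 0 1"
  let ?F = "\<lambda>c. law_of c ?x (law_of c ?z ?z) - law_of c (law_of c ?x ?z) ?z"
  have "?F (structure_constants phi2) = 0"
  proof (rule zariski_closure_identity[OF _ _ mem])
    show "poly_vec ?F" by (intro poly_vec_intros)
    fix c assume "c \<in> law_orbit phi1"
    then obtain P where P: "invertible P" "law_of c = transport_law P phi1"
      using law_orbit_law_of[OF cbilinear_phi(1)] by blast
    have "phi1 x (phi1 y z) = phi1 (phi1 x y) z" for x y z
      by (simp add: phi1_eq coordinates algebra_simps)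
    then show "?F c = 0"
      by (simp add: P(2) transport_law_def matrix_inv_apply[OF P(1)])
  qed
  then show False
    by (simp add: law_of_structure_constants cbilinear_phi) (simp add: phi2_eq coordinates)
qed

text \<open>Vanishing of all products of four factors is a closed condition that holds for \<open>phi2\<close>, whereas
  \<open>((e\<^sub>1 e\<^sub>1) e\<^sub>1) e\<^sub>1 = e\<^sub>4\<close> for \<open>phi1\<close>.\<close>

lemma phi1_not_in_closure_phi2: "structure_constants phi1 \<notin> zariski closure_of law_orbit phi2"
proof
  assume mem: "structure_constants phi1 \<in> zariski closure_of law_orbit phi2"
  let ?x = "vec4 1 0 0 0"
  let ?F = "\<lambda>c. law_of c (law_of c (law_of c ?x ?x) ?x) ?x"
  have "?F (structure_constants phi1) = 0"
  proof (rule zariski_closure_identity[OF _ _ mem])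
    show "poly_vec ?F" by (intro poly_vec_intros)
    fix c assume "c \<in> law_orbit phi2"
    then obtain P where P: "invertible P" "law_of c = transport_law P phi2"
      using law_orbit_law_of[OF cbilinear_phi(2)] by blast
    have "phi2 (phi2 (phi2 x y) z) u = 0" for x y z u
      by (simp add: phi2_eq coordinates)
    then show "?F c = 0"
      by (simp add: P(2) transport_law_def matrix_inv_apply[OF P(1)])
  qed
  then show False
    by (simp add: law_of_structure_constants cbilinear_phi) (simp add: phi1_eq coordinates)
qed

theorem theorem3p6:
  "(nilpotent_jordan_variety :: (complex^(4 \<times> 4 \<times> 4)) set) =
     zariski closure_of law_orbit phi1 \<union> zariski closure_of law_orbit phi2 \<and>
   irreducible_components
     (subtopology zariski (nilpotent_jordan_variety :: (complex^(4 \<times> 4 \<times> 4)) set)) =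
     {zariski closure_of law_orbit phi1, zariski closure_of law_orbit phi2} \<and>
   zariski closure_of law_orbit phi1 \<noteq> zariski closure_of law_orbit phi2"
proof (intro conjI)
  let ?C1 = "zariski closure_of law_orbit phi1" and ?C2 = "zariski closure_of law_orbit phi2"
  let ?V = "nilpotent_jordan_variety :: (complex^(4 \<times> 4 \<times> 4)) set"
  have "?C1 \<subseteq> ?V"
    by (intro orbit_closure_subset_variety)
      (simp_all add: jordan_law_def cbilinear_phi, simp_all add: phi1_eq coordinates algebra_simps)
  moreover have "?C2 \<subseteq> ?V"
    by (intro orbit_closure_subset_variety)
      (simp_all add: jordan_law_def cbilinear_phi, simp_all add: phi2_eq coordinates algebra_simps)
  moreover have "?V \<subseteq> ?C1 \<union> ?C2"
    using nilpotent_jordan_in_closures unfolding nilpotent_jordan_variety_def by auto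
  ultimately show V: "?V = ?C1 \<union> ?C2" by blast
  have mem: "structure_constants phi1 \<in> ?C1" "structure_constants phi2 \<in> ?C2"
    using self_in_law_orbit closure_of_subset[of "law_orbit phi1" zariski]
      closure_of_subset[of "law_orbit phi2" zariski] by auto
  show "?C1 \<noteq> ?C2" using mem phi1_not_in_closure_phi2 by blast
  show "irreducible_components (subtopology zariski ?V) = {?C1, ?C2}"
  proof (rule irreducible_components_two)
    show "topspace (subtopology zariski ?V) = ?C1 \<union> ?C2" using V by simp
    have sub: "?C1 \<subseteq> ?V" "?C2 \<subseteq> ?V" using V by auto
    then show "closedin (subtopology zariski ?V) ?C1" "closedin (subtopology zariski ?V) ?C2"
      by (simp_all add: closedin_subset_topspace)
    show "irreducible_space (subtopology (subtopology zariski ?V) ?C1)"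
      "irreducible_space (subtopology (subtopology zariski ?V) ?C2)"
      using irreducible_orbit_closure cbilinear_phi sub
      by (simp_all add: subtopology_subtopology Int_absorb1)
    show "\<not> ?C1 \<subseteq> ?C2" "\<not> ?C2 \<subseteq> ?C1"
      using mem phi1_not_in_closure_phi2 phi2_not_in_closure_phi1 by blast+
  qed
qed

end
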